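(* Let $G_1$ be a simple connected graph, $v\in V(G_1)$, $k\ge2$, and let $G=G_1\oplus_vS_{k+1}$ be the graph obtained by attaching $k$ new pendant vertices to $v$ (the star $S_{k+1}$ with its central vertex identified with $v$). Let $\mathscr L$ be any set of $l\ge1$ pairs of distinct vertices of the star $S_{k+1}$ that are not edges (i.e. pairs of the new pendant vertices). Then $\mathscr L$ is a Braess set of $G$ provided $$|E(G_1)|>\begin{cases}\frac18\left[\sqrt{33l^2+50l+17}-l-1\right]&\text{if } l<k,\\[2pt] \frac18\left[\sqrt{33k^2-30k+1}-k-1\right]&\text{if } l\ge k.\end{cases}$$
   Context: For connected $H$ with $m\ge1$ edges and degrees $d_i$, Kemeny's constant is $\mathscr{K}(H)=\sum_j\pi_jm_{ij}$ for the simple random walk on $H$ ($\pi_j=d_j/2m$, $m_{ij}$ expected hitting time of $j$ from $i$, $m_{jj}=0$), equivalently $\frac1{4m}\sum_{i,j}d_id_jr_H(i,j)$ with $r_H$ effective resistance. A Braess set of a graph $G$ is a set of non-edges of $G$ such that adding all of them to $G$ strictly increases Kemeny's constant. *)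

theory Defs
  imports "HOL-Probability.Probability"
begin

record 'a ugraph =
  verts :: "'a set"
  edges :: "'a set set"

definition simple_graph :: "'a ugraph \<Rightarrow> bool" where
  "simple_graph G \<longleftrightarrow>
     finite (verts G) \<and> (\<forall>e \<in> edges G. e \<subseteq> verts G \<and> card e = 2)"

definition connected_graph :: "'a ugraph \<Rightarrow> bool" where
  "connected_graph G \<longleftrightarrow> verts G \<noteq> {} \<and>
     (\<forall>u \<in> verts G. \<forall>w \<in> verts G. (u, w) \<in> {(x, y). {x, y} \<in> edges G}\<^sup>*)"

definition non_edges :: "'a ugraph \<Rightarrow> 'a set set" where
  "non_edges G = {e. e \<subseteq> verts G \<and> card e = 2 \<and> e \<notin> edges G}"

definition add_edges :: "'a ugraph \<Rightarrow> 'a set set \<Rightarrow> 'a ugraph" where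
  "add_edges G L = \<lparr>verts = verts G, edges = edges G \<union> L\<rparr>"

definition star_graph :: "'a \<Rightarrow> 'a set \<Rightarrow> 'a ugraph" where
  "star_graph v P = \<lparr>verts = insert v P, edges = (\<lambda>p. {v, p}) ` P\<rparr>"

text \<open>When two graphs share exactly one vertex \<open>v\<close>, their union is the graph
  obtained by identifying the two copies of \<open>v\<close>.\<close>

definition graph_union :: "'a ugraph \<Rightarrow> 'a ugraph \<Rightarrow> 'a ugraph" where
  "graph_union G H = \<lparr>verts = verts G \<union> verts H, edges = edges G \<union> edges H\<rparr>"

definition nbrs :: "'a ugraph \<Rightarrow> 'a \<Rightarrow> 'a set" where
  "nbrs G i = {j \<in> verts G. {i, j} \<in> edges G}"

definition deg :: "'a ugraph \<Rightarrow> 'a \<Rightarrow> nat" where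
  "deg G i = card (nbrs G i)"

text \<open>Law of the trajectory \<open>[X\<^sub>0, \<dots>, X\<^sub>n]\<close> of the simple random walk started at \<open>X\<^sub>0 = i\<close>.
  Every vertex reached needs a neighbour, which holds in connected graphs with an edge.\<close>

primrec random_walk :: "'a ugraph \<Rightarrow> nat \<Rightarrow> 'a \<Rightarrow> 'a list pmf" where
  "random_walk G 0 i = return_pmf [i]"
| "random_walk G (Suc n) i =
     bind_pmf (pmf_of_set (nbrs G i)) (\<lambda>k. map_pmf ((#) i) (random_walk G n k))"

text \<open>\<open>P(T\<^sub>j = n)\<close> for \<open>T\<^sub>j = min {n \<ge> 0. X\<^sub>n = j}\<close> and the walk started at \<open>i\<close>.\<close>

definition hitting_prob :: "'a ugraph \<Rightarrow> 'a \<Rightarrow> 'a \<Rightarrow> nat \<Rightarrow> real" where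
  "hitting_prob G i j n =
     measure_pmf.prob (random_walk G n i) {xs. last xs = j \<and> j \<notin> set (butlast xs)}"

text \<open>The expectation of \<open>T\<^sub>j\<close>. On a finite connected graph, \<open>T\<^sub>j\<close> is almost surely
  finite and the series converges; no other case is intended. As \<open>T\<^sub>j\<close> counts
  time \<open>0\<close>, the value for \<open>i = j\<close> is \<open>0\<close>.\<close>

definition hitting_time :: "'a ugraph \<Rightarrow> 'a \<Rightarrow> 'a \<Rightarrow> real" where
  "hitting_time G i j = (\<Sum>n. real n * hitting_prob G i j n)"

definition stationary :: "'a ugraph \<Rightarrow> 'a \<Rightarrow> real" where
  "stationary G j = real (deg G j) / (2 * real (card (edges G)))"

text \<open>The common value, over all starting vertices \<open>i\<close>, of the stationary average of the
  hitting times from \<open>i\<close>.\<close>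

definition kemeny :: "'a ugraph \<Rightarrow> real" where
  "kemeny G =
     (THE K. \<forall>i \<in> verts G. K = (\<Sum>j \<in> verts G. stationary G j * hitting_time G i j))"

definition braess_set :: "'a ugraph \<Rightarrow> 'a set set \<Rightarrow> bool" where
  "braess_set G L \<longleftrightarrow> L \<subseteq> non_edges G \<and> kemeny G < kemeny (add_edges G L)"

end

theory Submission
  imports Defs
begin

text \<open>
  Let \<open>g\<close> be the inverse of the Laplacian grounded at \<open>v\<close> (extended by \<open>0\<close>) and \<open>d\<close> the degrees. The
  hitting times are \<open>2m (g j j - g i j) + (\<Sum>k. d k * (g i k - g j k))\<close>, so Kemeny's constant is
  \<open>T - A / 2m\<close> with \<open>T = \<Sum>i. d i * g i i\<close> and \<open>A = \<Sum>i j. d i * d j * g i j\<close>. Since \<open>g\<close> is block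
  diagonal at the cut vertex \<open>v\<close>, both \<open>T\<close> and \<open>A\<close> are additive over \<open>G1\<close> and the star. The
  contribution of \<open>G1\<close> satisfies \<open>A \<ge> m\<close>, where \<open>m\<close> is its number of edges, and it remains to show
  \<open>A < 2 (m + k + l) (T - k) + k + l\<close> for the star with the new edges. This is implied by the same
  statement for each component of the new edges, where \<open>l \<ge> k - 1\<close>.

  For a component, \<open>T - k \<ge> 4 l\<^sup>2 / (k (2 l + k - 1))\<close> follows by inserting combinations of a point mass
  and a constant into the variational characterisation of \<open>g i i\<close>. The bound on \<open>A\<close> comes from
  \<open>T - A / 2m \<ge> n - 2 + (tr P\<^sup>2 - 1) / 2\<close>, valid for every graph with \<open>n\<close> vertices and transition
  matrix \<open>P\<close> (its eigenvalues satisfy \<open>1 / (1 - \<lambda>) \<ge> 1 + \<lambda> + \<lambda>\<^sup>2 / 2\<close>), because \<open>v\<close> is adjacent to all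
  other vertices and so \<open>tr P\<^sup>2 \<ge> 1 + k / (k + 2 l)\<close>.
\<close>

section \<open>Hitting times\<close>

lemma random_walk_nonempty: "xs \<in> set_pmf (random_walk G n i) \<Longrightarrow> xs \<noteq> []"
  by (cases n) auto

lemma hitting_prob_0: "hitting_prob G i j 0 = of_bool (i = j)"
  by (simp add: hitting_prob_def measure_return_pmf indicator_def)

lemma hitting_prob_Suc:
  assumes "finite (nbrs G i)" "nbrs G i \<noteq> {}"
  shows "hitting_prob G i j (Suc n) =
    (if i = j then 0 else (\<Sum>k\<in>nbrs G i. hitting_prob G k j n) / real (deg G i))"
proof -
  let ?H = "{xs. last xs = j \<and> j \<notin> set (butlast xs)}"
  have step: "measure_pmf.prob (map_pmf ((#) i) (random_walk G n k)) ?H =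
      (if i = j then 0 else hitting_prob G k j n)" for k
  proof -
    have "measure_pmf.prob (map_pmf ((#) i) (random_walk G n k)) ?H =
        measure_pmf.prob (random_walk G n k) ((#) i -` ?H)"
      by simp
    \<comment> \<open>Trajectories are nonempty, so \<open>butlast (i # xs)\<close> contains
      \<open>i\<close>: for \<open>i = j\<close> the event becomes impossible, otherwise prefixing
      \<open>i\<close> does not affect it.\<close>
    also have "\<dots> = measure_pmf.prob (random_walk G n k) (if i = j then {} else ?H)"
      by (rule measure_pmf.finite_measure_eq_AE)
         (auto simp: AE_measure_pmf_iff dest: random_walk_nonempty)
    finally show ?thesis
      by (simp add: hitting_prob_def)
  qed
  have "hitting_prob G i j (Suc n) =
      measure_pmf.expectation (pmf_of_set (nbrs G i))
        (\<lambda>k. measure_pmf.prob (map_pmf ((#) i) (random_walk G n k)) ?H)"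
    unfolding hitting_prob_def random_walk.simps measure_pmf_bind
    by (rule measure_pmf.measure_bind[where N = "count_space UNIV"])
       (auto simp: measure_pmf_in_subprob_algebra)
  then show ?thesis
    unfolding step using assms by (simp add: integral_pmf_of_set deg_def)
qed

section \<open>Expectations as sums of tail probabilities\<close>

text \<open>Olivier's theorem: past an index \<open>M\<close> with small tail sums, monotonicity
  gives \<open>(n - M) * u n \<le> sum u {M..<n}\<close>, and the missing \<open>M * u n\<close>
  tends to 0.\<close>

lemma decseq_summable_imp_mult_tendsto_0:
  fixes u :: "nat \<Rightarrow> real"
  assumes "decseq u" "summable u" "\<And>n. u n \<ge> 0"
  shows "(\<lambda>n. real n * u n) \<longlonglongrightarrow> 0"
proof (rule LIMSEQ_I)
  fix e :: real assume "e > 0"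
  obtain M where M: "\<And>n. norm (sum u {M..<n}) < e / 2"
    using summable_Cauchy[of u] assms(2) \<open>e > 0\<close> by (meson half_gt_zero order_refl)
  have "(\<lambda>n. real M * u n) \<longlonglongrightarrow> 0"
    using tendsto_mult[OF tendsto_const summable_LIMSEQ_zero[OF assms(2)], of "real M"] by simp
  then obtain N where N: "\<And>n. n \<ge> N \<Longrightarrow> norm (real M * u n - 0) < e / 2"
    using \<open>e > 0\<close> LIMSEQ_D by (meson half_gt_zero)
  show "\<exists>N. \<forall>n\<ge>N. norm (real n * u n - 0) < e"
  proof (intro exI allI impI)
    fix n assume n: "n \<ge> max M N"
    have "real (n - M) * u n = (\<Sum>i=M..<n. u n)" by simp
    also have "\<dots> \<le> sum u {M..<n}"
      using assms(1) by (intro sum_mono) (simp add: decseq_def)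
    also have "\<dots> < e / 2" using M[of n] by simp
    finally have "real n * u n < e / 2 + real M * u n"
      using n by (simp add: of_nat_diff algebra_simps)
    also have "\<dots> < e" using N[of n] n assms(3)[of n] by simp
    finally show "norm (real n * u n - 0) < e" using assms(3)[of n] by simp
  qed
qed

text \<open>Summation by parts, with boundary term \<open>N * u N\<close>. If \<open>u n\<close> is
  the probability of T > n and \<open>p n\<close> that of T = n, this turns the expectation of T
  into the sum of its tails.\<close>

lemma sums_weighted_differences:
  fixes u p :: "nat \<Rightarrow> real"
  assumes "u sums s" "\<And>n. u n \<ge> 0" "decseq u" "\<And>n. p (Suc n) = u n - u (Suc n)"
  shows "(\<lambda>n. real n * p n) sums s"
proof -
  have part: "(\<Sum>n<Suc N. real n * p n) = (\<Sum>n<N. u n) - real N * u N" for N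
    by (induction N) (simp_all add: assms(4) algebra_simps)
  have "(\<lambda>N. (\<Sum>n<N. u n) - real N * u N) \<longlonglongrightarrow> s - 0"
    using assms(1-3) sums_summable[OF assms(1)] unfolding sums_def
    by (intro tendsto_diff decseq_summable_imp_mult_tendsto_0) auto
  then have "(\<lambda>N. \<Sum>n<Suc N. real n * p n) \<longlonglongrightarrow> s"
    unfolding part by simp
  then show ?thesis
    unfolding sums_def by (rule LIMSEQ_imp_Suc)
qed

text \<open>Iterating the first-step equation writes \<open>h i\<close> as the sum of P(T > m) over
  m < n plus the expectation of \<open>h\<close> at time n on the event T > n. This remainder lies
  between 0 and a multiple of P(T > n), so the tails are summable, the remainder vanishes and
  \<open>h i\<close> is the expectation of T.\<close>

lemma hitting_time_eqI:
  fixes G :: "'a ugraph" and h :: "'a \<Rightarrow> real"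
  assumes fin: "finite (verts G)" and ne: "\<And>i. i \<in> verts G \<Longrightarrow> nbrs G i \<noteq> {}"
    and j: "j \<in> verts G" "h j = 0"
    and h: "\<And>i. i \<in> verts G \<Longrightarrow> i \<noteq> j \<Longrightarrow> h i = 1 + (\<Sum>n\<in>nbrs G i. h n) / real (deg G i)"
    and i: "i \<in> verts G"
  shows "hitting_time G i j = h i"
proof -
  define avg where "avg = (\<lambda>i f. (\<Sum>n\<in>nbrs G i. f n :: real) / real (deg G i))"
  have sub: "nbrs G i \<subseteq> verts G" for i by (auto simp: nbrs_def)
  have finn: "finite (nbrs G i)" for i using fin sub finite_subset by blast
  have degp: "deg G i > 0" if "i \<in> verts G" for i
    using ne[OF that] finn by (simp add: deg_def card_gt_0_iff)
  have avg_mono: "avg i f \<le> avg i f'" if "\<And>n. n \<in> verts G \<Longrightarrow> f n \<le> f' n" for i f f'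
    unfolding avg_def using that sub by (intro divide_right_mono sum_mono) auto
  have avg_const: "avg i (\<lambda>_. c) = c" if "i \<in> verts G" for i c
    using degp[OF that] unfolding avg_def by (simp add: deg_def)
  have avg_diff: "avg i (\<lambda>n. f n - f' n) = avg i f - avg i f'" for i f f'
    by (simp add: avg_def sum_subtractf diff_divide_distrib)
  have avg_sum: "avg i (\<lambda>n. \<Sum>m\<in>S. f m n) = (\<Sum>m\<in>S. avg i (f m))" for i f and S :: "nat set"
    by (simp add: avg_def sum_divide_distrib sum.swap[of _ S])
  have avg_mult: "avg i (\<lambda>n. c * f n) = c * avg i f" for i f c
    by (simp add: avg_def sum_distrib_left)

  \<comment> \<open>\<open>u n i\<close> is the probability that \<open>j\<close> is not hit up to time \<open>n\<close>.\<close>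
  define u where "u = (\<lambda>n i. 1 - (\<Sum>m\<le>n. hitting_prob G i j m))"
  have hpS: "hitting_prob G i j (Suc n) = (if i = j then 0 else avg i (\<lambda>k. hitting_prob G k j n))"
    if "i \<in> verts G" for i n
    using hitting_prob_Suc[OF finn ne[OF that]] by (simp add: avg_def)
  have u0: "u 0 i = of_bool (i \<noteq> j)" for i
    by (simp add: u_def hitting_prob_0)
  have uS: "u (Suc n) i = (if i = j then 0 else avg i (u n))" if "i \<in> verts G" for n i
  proof -
    have "u (Suc n) i = 1 - hitting_prob G i j 0 - (\<Sum>m\<le>n. hitting_prob G i j (Suc m))"
      unfolding u_def by (subst sum.atMost_Suc_shift) simp
    also have "\<dots> = (if i = j then 0 else avg i (u n))"
      using that by (simp add: hpS hitting_prob_0 u_def avg_diff avg_const avg_sum)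
    finally show ?thesis .
  qed
  have u_nonneg: "u n i \<ge> 0" if "i \<in> verts G" for n i
    using that
  proof (induction n arbitrary: i)
    case (Suc n)
    then show ?case using avg_mono[of "\<lambda>_. 0" "u n" i] by (simp add: uS avg_const)
  qed (simp add: u0)
  have hp_nonneg: "hitting_prob G i j n \<ge> 0" for i n by (simp add: hitting_prob_def)
  have u_step: "hitting_prob G i j (Suc n) = u n i - u (Suc n) i" for i n
    by (simp add: u_def)
  have u_dec: "decseq (\<lambda>n. u n i)" for i
    using hp_nonneg u_step by (intro decseq_SucI) (metis diff_ge_0_iff_ge)

  \<comment> \<open>Minimum principle: away from \<open>j\<close> the value exceeds an average of
    values by 1, so the minimum can only be attained at \<open>j\<close>, where \<open>h\<close> is
    0.\<close>
  have h_nonneg: "h k \<ge> 0" if "k \<in> verts G" for k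
  proof -
    obtain a where a: "a \<in> verts G" "\<And>n. n \<in> verts G \<Longrightarrow> h a \<le> h n"
      using fin \<open>i \<in> verts G\<close> by (metis arg_min_if_finite(1) arg_min_least empty_iff)
    have "a = j"
    proof (rule ccontr)
      assume "a \<noteq> j"
      then have "h a = 1 + avg a h" using h a by (simp add: avg_def)
      then show False using avg_mono[of "\<lambda>_. h a" h a] a by (simp add: avg_const)
    qed
    then show ?thesis using a(2)[OF that] j by simp
  qed
  define C where "C = Max (h ` verts G)"
  have hC: "h i \<le> C" if "i \<in> verts G" for i
    using fin that by (simp add: C_def)
  \<comment> \<open>\<open>R n i\<close> is the expectation of \<open>h\<close> at time \<open>n\<close> on the event that \<open>j\<close> has not been hit.\<close>
  define R where "R = (\<lambda>n i. h i - (\<Sum>m<n. u m i))"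
  have uj: "u n j = 0" for n using uS[OF j(1)] u0 by (cases n) auto
  have RS: "R (Suc n) i = (if i = j then 0 else avg i (R n))" if "i \<in> verts G" for n i
  proof (cases "i = j")
    case False
    have "R (Suc n) i = h i - 1 - (\<Sum>m<n. u (Suc m) i)"
      using False by (simp add: R_def sum.lessThan_Suc_shift u0 del: sum.lessThan_Suc)
    also have "\<dots> = avg i h - (\<Sum>m<n. avg i (u m))"
    proof -
      have "h i - 1 = avg i h" using h[OF that False] unfolding avg_def by linarith
      then show ?thesis using False that by (simp only: uS if_False)
    qed
    also have "\<dots> = avg i (R n)"
      unfolding R_def avg_diff avg_sum ..
    finally show ?thesis using False by simp
  qed (simp add: R_def uj j)
  have R_bounds: "0 \<le> R n i \<and> R n i \<le> C * u n i" if "i \<in> verts G" for n i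
    using that
  proof (induction n arbitrary: i)
    case 0
    then show ?case using h_nonneg hC j by (simp add: R_def u0)
  next
    case (Suc n)
    then show ?case
      using avg_mono[of "\<lambda>_. 0" "R n" i] avg_mono[of "R n" "\<lambda>k. C * u n k" i]
      by (simp add: RS uS avg_const avg_mult)
  qed
  \<comment> \<open>Nonnegativity of \<open>R\<close> bounds the partial sums by \<open>h i\<close>.
    Summability then sends \<open>u n i\<close> to 0, which squeezes \<open>R\<close> to 0.\<close>
  have "summable (\<lambda>n. u n i)"
  proof (rule summableI_nonneg_bounded)
    show "(\<Sum>m<n. u m i) \<le> h i" for n using R_bounds[OF i, of n] by (simp add: R_def)
  qed (rule u_nonneg[OF i])
  then have "(\<lambda>n. u n i) \<longlonglongrightarrow> 0" by (rule summable_LIMSEQ_zero)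
  from tendsto_mult[OF tendsto_const this, of C] have "(\<lambda>n. C * u n i) \<longlonglongrightarrow> 0" by simp
  then have "(\<lambda>n. R n i) \<longlonglongrightarrow> 0"
    by (rule tendsto_sandwich[OF _ _ tendsto_const, rotated 2]) (use R_bounds[OF i] in \<open>simp_all\<close>)
  from tendsto_diff[OF tendsto_const this, of "h i"] have "(\<lambda>n. u n i) sums h i"
    by (simp add: R_def sums_def)
  then have "(\<lambda>n. real n * hitting_prob G i j n) sums h i"
    by (rule sums_weighted_differences[OF _ u_nonneg[OF i] u_dec u_step])
  then show ?thesis
    by (simp add: hitting_time_def sums_iff)
qed

section \<open>Green functions of networks\<close>

definition wdeg :: "('a \<Rightarrow> 'a \<Rightarrow> real) \<Rightarrow> 'a set \<Rightarrow> 'a \<Rightarrow> real" where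
  "wdeg a V i = (\<Sum>j\<in>V. a i j)"

definition vol :: "('a \<Rightarrow> 'a \<Rightarrow> real) \<Rightarrow> 'a set \<Rightarrow> real" where
  "vol a V = (\<Sum>i\<in>V. wdeg a V i)"

definition lap :: "('a \<Rightarrow> 'a \<Rightarrow> real) \<Rightarrow> 'a set \<Rightarrow> ('a \<Rightarrow> real) \<Rightarrow> 'a \<Rightarrow> real" where
  "lap a V x i = wdeg a V i * x i - (\<Sum>j\<in>V. a i j * x j)"

definition energy :: "('a \<Rightarrow> 'a \<Rightarrow> real) \<Rightarrow> 'a set \<Rightarrow> ('a \<Rightarrow> real) \<Rightarrow> ('a \<Rightarrow> real) \<Rightarrow> real" where
  "energy a V x y = (\<Sum>i\<in>V. \<Sum>j\<in>V. a i j * (x i - x j) * (y i - y j)) / 2"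

text \<open>The values of \<open>g\<close> in row and column \<open>v\<close> are fixed to be \<open>0\<close>; values outside \<open>V\<close> are irrelevant.\<close>

definition green :: "('a \<Rightarrow> 'a \<Rightarrow> real) \<Rightarrow> 'a set \<Rightarrow> 'a \<Rightarrow> ('a \<Rightarrow> 'a \<Rightarrow> real) \<Rightarrow> bool" where
  "green a V v g \<longleftrightarrow> (\<forall>i. g v i = 0 \<and> g i v = 0) \<and>
     (\<forall>i\<in>V - {v}. \<forall>j\<in>V. lap a V (\<lambda>n. g n j) i = of_bool (i = j))"

text \<open>\<open>gtrace\<close> and \<open>gmass\<close> are T and A in the formula T - A / 2m for
  Kemeny's constant, with \<open>vol\<close> as 2m.\<close>

definition gtrace :: "('a \<Rightarrow> 'a \<Rightarrow> real) \<Rightarrow> 'a set \<Rightarrow> ('a \<Rightarrow> 'a \<Rightarrow> real) \<Rightarrow> real" where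
  "gtrace a V g = (\<Sum>i\<in>V. wdeg a V i * g i i)"

definition gmass :: "('a \<Rightarrow> 'a \<Rightarrow> real) \<Rightarrow> 'a set \<Rightarrow> ('a \<Rightarrow> 'a \<Rightarrow> real) \<Rightarrow> real" where
  "gmass a V g = (\<Sum>i\<in>V. \<Sum>j\<in>V. wdeg a V i * wdeg a V j * g i j)"

lemma sum_mult_of_bool:
  fixes f :: "'a \<Rightarrow> real"
  assumes "finite V" "i \<in> V"
  shows "(\<Sum>j\<in>V. of_bool (j = i) * f j) = f i" "(\<Sum>j\<in>V. of_bool (i = j) * f j) = f i"
    "(\<Sum>j\<in>V. f j * of_bool (j = i)) = f i" "(\<Sum>j\<in>V. f j * of_bool (i = j)) = f i"
  using assms by (simp_all add: of_bool_def if_distrib if_distribR cong: if_cong)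

text \<open>The vertex set stays a parameter of \<open>wdeg\<close>, \<open>lap\<close> and the
  others, so that one weight function can be restricted to the two sides of a cut vertex.\<close>

locale network =
  fixes a :: "'a \<Rightarrow> 'a \<Rightarrow> real"
  assumes a_sym: "a i j = a j i" and a_nonneg: "a i j \<ge> 0" and a_irrefl: "a i i = 0"
begin

lemma wdeg_nonneg: "wdeg a V i \<ge> 0"
  by (simp add: wdeg_def sum_nonneg a_nonneg)

section \<open>The Dirichlet form\<close>

lemma sum_lap: "(\<Sum>i\<in>V. y i * lap a V x i) = energy a V x y"
proof -
  let ?S = "\<lambda>f. \<Sum>i\<in>V. \<Sum>j\<in>V. a i j * f i j"
  have sw: "?S f = ?S (\<lambda>i j. f j i)" for f
    by (subst sum.swap) (simp add: a_sym)
  have "energy a V x y =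
      (?S (\<lambda>i j. x i * y i) - ?S (\<lambda>i j. x i * y j) - ?S (\<lambda>i j. x j * y i) + ?S (\<lambda>i j. x j * y j)) / 2"
    unfolding energy_def
    by (simp add: algebra_simps sum.distrib sum_subtractf)
  also have "\<dots> = ?S (\<lambda>i j. x i * y i) - ?S (\<lambda>i j. x j * y i)"
    using sw[of "\<lambda>i j. x i * y i"] sw[of "\<lambda>i j. x i * y j"] by simp
  also have "\<dots> = (\<Sum>i\<in>V. y i * lap a V x i)"
    unfolding lap_def wdeg_def
    by (simp add: algebra_simps sum_distrib_left sum_distrib_right sum_subtractf)
  finally show ?thesis by simp
qed

lemma energy_commute: "energy a V x y = energy a V y x"
  by (simp add: energy_def mult.commute mult.left_commute)

lemma energy_nonneg: "energy a V x x \<ge> 0"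
  unfolding energy_def by (intro divide_nonneg_nonneg sum_nonneg) (simp_all add: a_nonneg mult.assoc)

text \<open>The Dirichlet principle: expand the nonnegative energy of \<open>x - y\<close> and use
  that the energy of \<open>x\<close> against any function is its pairing with \<open>b\<close>.
  Every test function \<open>y\<close> thus bounds a quadratic form of the inverse Laplacian from
  below.\<close>

lemma energy_dual:
  assumes "\<And>i. i \<in> V \<Longrightarrow> lap a V x i = b i"
  shows "2 * (\<Sum>i\<in>V. b i * y i) - energy a V y y \<le> (\<Sum>i\<in>V. b i * x i)"
proof -
  have b: "(\<Sum>i\<in>V. b i * z i) = energy a V x z" for z
    unfolding sum_lap[symmetric] using assms by (intro sum.cong) auto
  have "0 \<le> energy a V (\<lambda>i. x i - y i) (\<lambda>i. x i - y i)" by (rule energy_nonneg)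
  also have "\<dots> = (\<Sum>i\<in>V. \<Sum>j\<in>V. a i j * (x i - x j) * (x i - x j) - a i j * (x i - x j) * (y i - y j)
      - a i j * (y i - y j) * (x i - x j) + a i j * (y i - y j) * (y i - y j)) / 2"
    unfolding energy_def by (intro arg_cong2[where f = "(/)"] sum.cong refl) (simp add: algebra_simps)
  also have "\<dots> = energy a V x x - energy a V x y - energy a V y x + energy a V y y"
    unfolding energy_def
    by (simp only: sum.distrib sum_subtractf add_divide_distrib diff_divide_distrib)
  finally show ?thesis by (simp add: b energy_commute[of V y x])
qed

text \<open>Edgewise this is (s - t)^2 \<le> 2 s^2 + 2 t^2; it says that the normalised Laplacian
  has no eigenvalue above 2.\<close>

lemma energy_le: "energy a V y y \<le> 2 * (\<Sum>i\<in>V. wdeg a V i * (y i)\<^sup>2)"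
proof -
  have "energy a V y y \<le> (\<Sum>i\<in>V. \<Sum>j\<in>V. a i j * (y i)\<^sup>2 + a i j * (y j)\<^sup>2)"
  proof -
    have "(y i - y j) * (y i - y j) \<le> 2 * (y i)\<^sup>2 + 2 * (y j)\<^sup>2" for i j
      using zero_le_power2[of "y i + y j"] by (simp add: power2_eq_square algebra_simps)
    from mult_left_mono[OF this a_nonneg]
    have "(\<Sum>i\<in>V. \<Sum>j\<in>V. a i j * (y i - y j) * (y i - y j)) \<le>
        (\<Sum>i\<in>V. \<Sum>j\<in>V. 2 * (a i j * (y i)\<^sup>2 + a i j * (y j)\<^sup>2))"
      by (intro sum_mono) (simp add: algebra_simps)
    then show ?thesis unfolding energy_def sum_distrib_left[symmetric] by linarith
  qed
  also have "\<dots> = (\<Sum>i\<in>V. \<Sum>j\<in>V. a i j * (y i)\<^sup>2) + (\<Sum>i\<in>V. \<Sum>j\<in>V. a i j * (y j)\<^sup>2)"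
    by (simp add: sum.distrib)
  also have "(\<Sum>i\<in>V. \<Sum>j\<in>V. a i j * (y j)\<^sup>2) = (\<Sum>i\<in>V. \<Sum>j\<in>V. a i j * (y i)\<^sup>2)"
    by (subst sum.swap) (simp add: a_sym)
  finally show ?thesis by (simp add: wdeg_def sum_distrib_right)
qed

lemma sum_lap_eq_0: "(\<Sum>i\<in>V. lap a V x i) = 0"
  using sum_lap[of "\<lambda>_. 1" V x] by (simp add: energy_def)

section \<open>The Green function grounded at a vertex\<close>

context
  fixes V v g
  assumes finV: "finite V" and v: "v \<in> V" and g: "green a V v g"
begin

lemma green_v [simp]: "g v i = 0" "g i v = 0"
  using g by (auto simp: green_def)

text \<open>The values of a Laplacian sum to 0, so the unit source at \<open>j\<close> is balanced
  by a unit sink at \<open>v\<close>. This supplies the equation in row \<open>v\<close>, which the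
  definition leaves out.\<close>

lemma green_lap:
  assumes "i \<in> V" "j \<in> V"
  shows "lap a V (\<lambda>n. g n j) i = of_bool (i = j) - of_bool (i = v)"
proof (cases "i = v")
  case False
  then show ?thesis using assms g by (simp add: green_def)
next
  case True
  have "lap a V (\<lambda>n. g n j) v + (\<Sum>i\<in>V - {v}. lap a V (\<lambda>n. g n j) i) = 0"
    using sum_lap_eq_0[of V "\<lambda>n. g n j"] sum.remove[OF finV v] by metis
  moreover have "(\<Sum>i\<in>V - {v}. lap a V (\<lambda>n. g n j) i) = (\<Sum>i\<in>V - {v}. of_bool (i = j))"
    using assms g by (intro sum.cong) (auto simp: green_def)
  moreover have "\<dots> = (if j = v then 0 else 1)"
    using finV assms by (simp add: of_bool_def)
  ultimately show ?thesis using True by auto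
qed

lemmas sum_of_bool_mult = sum_mult_of_bool[OF finV]

text \<open>The energy of columns \<open>i\<close> and \<open>j\<close> against each other,
  evaluated by summation by parts in either order, gives both entries.\<close>

lemma green_sym:
  assumes "i \<in> V" "j \<in> V"
  shows "g i j = g j i"
proof -
  have "(\<Sum>k\<in>V. g k i * lap a V (\<lambda>n. g n j) k) = g j i" if "i \<in> V" "j \<in> V" for i j
  proof -
    have "(\<Sum>k\<in>V. g k i * lap a V (\<lambda>n. g n j) k)
        = (\<Sum>k\<in>V. g k i * of_bool (k = j)) - (\<Sum>k\<in>V. g k i * of_bool (k = v))"
      using that by (simp add: green_lap right_diff_distrib sum_subtractf)
    then show ?thesis using that v by (simp add: sum_of_bool_mult)
  qed
  from this[of i j] this[of j i] show ?thesis
    using assms by (simp add: sum_lap energy_commute)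
qed

lemma sum_a_green:
  assumes "i \<in> V" "j \<in> V"
  shows "(\<Sum>n\<in>V. a i n * g n j) = wdeg a V i * g i j - of_bool (i = j) + of_bool (i = v)"
  using green_lap[OF assms] by (simp add: lap_def)

lemma gtrace_eq: "gtrace a V g = real (card V) - 1 + (\<Sum>i\<in>V. \<Sum>j\<in>V. a i j * g i j)"
proof -
  have "gtrace a V g = (\<Sum>i\<in>V. 1 - of_bool (i = v) * 1 + (\<Sum>n\<in>V. a i n * g n i))"
    unfolding gtrace_def by (intro sum.cong) (auto simp: sum_a_green)
  also have "\<dots> = real (card V) - 1 + (\<Sum>i\<in>V. \<Sum>n\<in>V. a i n * g n i)"
    using v by (simp only: sum.distrib sum_subtractf sum_of_bool_mult) simp
  also have "(\<Sum>i\<in>V. \<Sum>n\<in>V. a i n * g n i) = (\<Sum>i\<in>V. \<Sum>n\<in>V. a i n * g i n)"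
    by (intro sum.cong) (auto simp: green_sym)
  finally show ?thesis .
qed

section \<open>Lower bound for T - A / 2m by the trace of P^2\<close>

text \<open>As \<open>b\<close> sums to 0, the sinks at \<open>v\<close> cancel and \<open>g\<close>
  applied to \<open>b\<close> solves \<open>lap x = b\<close> at every vertex. The Dirichlet
  principle with test function b / (2 d), together with \<open>energy_le\<close>, gives the factor
  1/2.\<close>

lemma green_form_ge:
  assumes b: "(\<Sum>i\<in>V. b i) = 0" and pos: "\<And>i. i \<in> V \<Longrightarrow> wdeg a V i > 0"
  shows "(\<Sum>i\<in>V. (b i)\<^sup>2 / wdeg a V i) / 2 \<le> (\<Sum>i\<in>V. \<Sum>j\<in>V. b i * b j * g i j)"
proof -
  define x where "x = (\<lambda>i. \<Sum>j\<in>V. g i j * b j)"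
  have "lap a V x i = b i" if "i \<in> V" for i
  proof -
    have "lap a V x i = (\<Sum>j\<in>V. lap a V (\<lambda>n. g n j) i * b j)"
      unfolding lap_def x_def
      by (simp add: sum_distrib_left sum_distrib_right left_diff_distrib sum_subtractf mult.assoc
           sum.swap[of "\<lambda>j k. a i j * (g j k * b k)"])
    also have "\<dots> = (\<Sum>j\<in>V. of_bool (i = j) * b j) - of_bool (i = v) * (\<Sum>j\<in>V. b j)"
      using that by (simp add: green_lap left_diff_distrib sum_subtractf sum_distrib_left)
    finally show ?thesis using that b by (simp add: sum_of_bool_mult)
  qed
  note energy_dual[OF this, where y = "\<lambda>i. b i / (2 * wdeg a V i)"]
  moreover have "(\<Sum>i\<in>V. b i * x i) = (\<Sum>i\<in>V. \<Sum>j\<in>V. b i * b j * g i j)"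
    by (simp add: x_def sum_distrib_left algebra_simps)
  moreover have "(\<Sum>i\<in>V. b i * (b i / (2 * wdeg a V i))) = (\<Sum>i\<in>V. (b i)\<^sup>2 / wdeg a V i) / 2"
    by (simp add: sum_divide_distrib power2_eq_square mult.commute)
  moreover have "(\<Sum>i\<in>V. wdeg a V i * (b i / (2 * wdeg a V i))\<^sup>2) = (\<Sum>i\<in>V. (b i)\<^sup>2 / wdeg a V i) / 4"
    unfolding sum_divide_distrib using pos
    by (intro sum.cong) (auto simp: power2_eq_square field_simps dest!: pos)
  ultimately show ?thesis
    using energy_le[of V "\<lambda>i. b i / (2 * wdeg a V i)"] by simp
qed

text \<open>In spectral terms T - A / 2m is the sum of 1 / (1 - \<lambda>) = 1 + \<lambda> +
  \<lambda>^2 / (1 - \<lambda>) over the eigenvalues of P other than one eigenvalue 1. The first two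
  terms add up to n - 2 because the trace of P is 0; the right side is the sum of the third. The
  rows of \<open>b\<close> are those of the weights with the stationary part removed.\<close>

lemma gtrace_gmass_excess:
  assumes pos: "\<And>i. i \<in> V \<Longrightarrow> wdeg a V i > 0"
  defines "b \<equiv> \<lambda>j i. a j i - wdeg a V j * wdeg a V i / vol a V"
  shows "gtrace a V g - gmass a V g / vol a V - (real (card V) - 2) =
    (\<Sum>j\<in>V. (\<Sum>i\<in>V. \<Sum>n\<in>V. b j i * b j n * g i n) / wdeg a V j)"
proof -
  define d where "d = wdeg a V"
  define W where "W = vol a V"
  have W: "W > 0" unfolding W_def vol_def using finV v pos by (intro sum_pos) auto
  have dpos: "d i > 0" if "i \<in> V" for i using pos that by (simp add: d_def)
  have summand: "(\<Sum>i\<in>V. \<Sum>n\<in>V. b j i * b j n * g i n) / d j =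
     (\<Sum>i\<in>V. a j i * g j i) + of_bool (j = v) * 1
     - 2 / W * (\<Sum>i\<in>V. \<Sum>n\<in>V. a j i * d n * g i n) + d j / W\<^sup>2 * gmass a V g" (is "?l = ?r")
    if j: "j \<in> V" for j
  proof -
    let ?X = "\<Sum>i\<in>V. \<Sum>n\<in>V. a j i * d n * g i n"
    have X': "(\<Sum>i\<in>V. \<Sum>n\<in>V. d i * a j n * g i n) = ?X"
      by (subst sum.swap, intro sum.cong refl) (simp add: green_sym)
    have "(\<Sum>i\<in>V. \<Sum>n\<in>V. b j i * b j n * g i n) =
      (\<Sum>i\<in>V. \<Sum>n\<in>V. a j i * a j n * g i n - d j / W * (a j i * d n * g i n)
         - d j / W * (d i * a j n * g i n) + (d j)\<^sup>2 / W\<^sup>2 * (d i * d n * g i n))"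
      unfolding b_def d_def[symmetric] W_def[symmetric]
      by (intro sum.cong refl) (simp add: algebra_simps diff_divide_distrib power2_eq_square)
    also have "\<dots> = (\<Sum>i\<in>V. \<Sum>n\<in>V. a j i * a j n * g i n) - d j / W * ?X - d j / W * ?X
        + (d j)\<^sup>2 / W\<^sup>2 * gmass a V g"
      unfolding gmass_def d_def[symmetric]
      by (simp only: sum.distrib sum_subtractf sum_distrib_left[symmetric] X')
    \<comment> \<open>Only this term needs the equation satisfied by \<open>g\<close>. The identity
      part of \<open>sum_a_green\<close> contributes \<open>a j j\<close>, which is 0.\<close>
    also have "(\<Sum>i\<in>V. \<Sum>n\<in>V. a j i * a j n * g i n)
        = (\<Sum>i\<in>V. a j i * (\<Sum>n\<in>V. a j n * g n i))"
      unfolding sum_distrib_left by (intro sum.cong refl) (simp add: green_sym)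
    also have "\<dots> = (\<Sum>i\<in>V. d j * (a j i * g j i) - a j i * of_bool (j = i) + of_bool (j = v) * a j i)"
      using j by (intro sum.cong refl) (simp add: sum_a_green d_def algebra_simps)
    also have "\<dots> = d j * (\<Sum>i\<in>V. a j i * g j i) + of_bool (j = v) * d j"
      using j by (simp only: sum.distrib sum_subtractf sum_of_bool_mult a_irrefl
          sum_distrib_left[symmetric]) (simp add: d_def wdeg_def)
    finally show ?thesis using dpos[OF j] W
      by (simp add: field_simps power2_eq_square)
  qed
  have m: "(\<Sum>j\<in>V. \<Sum>i\<in>V. \<Sum>n\<in>V. a j i * d n * g i n) = gmass a V g"
  proof -
    have "(\<Sum>j\<in>V. \<Sum>i\<in>V. \<Sum>n\<in>V. a j i * d n * g i n) = (\<Sum>i\<in>V. \<Sum>j\<in>V. \<Sum>n\<in>V. a j i * d n * g i n)"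
      by (rule sum.swap)
    also have "\<dots> = (\<Sum>i\<in>V. \<Sum>n\<in>V. \<Sum>j\<in>V. a j i * d n * g i n)"
      by (intro sum.cong refl sum.swap)
    also have "\<dots> = (\<Sum>i\<in>V. \<Sum>n\<in>V. d i * d n * g i n)"
    proof -
      have "(\<Sum>j\<in>V. a j i) = d i" for i by (simp add: d_def wdeg_def a_sym)
      then show ?thesis by (simp flip: sum_distrib_right)
    qed
    also have "\<dots> = gmass a V g" by (simp add: gmass_def d_def)
    finally show ?thesis .
  qed
  have "(\<Sum>j\<in>V. (\<Sum>i\<in>V. \<Sum>n\<in>V. b j i * b j n * g i n) / wdeg a V j) =
     (\<Sum>j\<in>V. (\<Sum>i\<in>V. a j i * g j i) + of_bool (j = v) * 1
     - 2 / W * (\<Sum>i\<in>V. \<Sum>n\<in>V. a j i * d n * g i n) + d j / W\<^sup>2 * gmass a V g)"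
    using summand by (intro sum.cong refl) (simp add: d_def)
  also have "\<dots> = (\<Sum>j\<in>V. \<Sum>i\<in>V. a j i * g j i) + 1 - 2 / W * gmass a V g + W / W\<^sup>2 * gmass a V g"
    using v sum_of_bool_mult(1)[OF v, of "\<lambda>_. 1"]
    by (simp only: sum.distrib sum_subtractf sum_of_bool_mult m sum_distrib_left[symmetric]
        sum_distrib_right[symmetric] sum_divide_distrib[symmetric])
      (simp add: W_def vol_def d_def)
  finally show ?thesis
    using W by (simp add: gtrace_eq W_def[symmetric] field_simps power2_eq_square)
qed

lemma gtrace_gmass_ge:
  assumes pos: "\<And>i. i \<in> V \<Longrightarrow> wdeg a V i > 0"
  shows "real (card V) - 2 + ((\<Sum>i\<in>V. \<Sum>j\<in>V. (a i j)\<^sup>2 / (wdeg a V i * wdeg a V j)) - 1) / 2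
    \<le> gtrace a V g - gmass a V g / vol a V"
proof -
  define d where "d = wdeg a V"
  define W where "W = vol a V"
  have W: "W > 0" unfolding W_def vol_def using finV v pos by (intro sum_pos) auto
  have dpos: "d i > 0" if "i \<in> V" for i using pos that by (simp add: d_def)
  have dsum: "(\<Sum>i\<in>V. d i) = W" by (simp add: d_def W_def vol_def)
  define b where "b = (\<lambda>j i. a j i - d j * d i / W)"
  have b0: "(\<Sum>i\<in>V. b j i) = 0" for j
  proof -
    have "(\<Sum>i\<in>V. b j i) = d j - d j * (\<Sum>i\<in>V. d i) / W"
      unfolding b_def sum_subtractf by (simp add: d_def wdeg_def sum_distrib_left sum_divide_distrib)
    then show ?thesis using W dsum by simp
  qed
  \<comment> \<open>Completing the square: the mixed terms sum to 2 and the last ones to 1, a net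
    loss of 1. This is the contribution of the eigenvalue 1 to the trace of P^2.\<close>
  have "((\<Sum>i\<in>V. \<Sum>j\<in>V. (a i j)\<^sup>2 / (d i * d j)) - 1) / 2
      = (\<Sum>i\<in>V. \<Sum>j\<in>V. (a i j)\<^sup>2 / (d i * d j) - 2 / W * a i j + d i * d j / W\<^sup>2) / 2"
  proof -
    have 1: "(\<Sum>i\<in>V. \<Sum>j\<in>V. a i j) = W" by (simp add: W_def vol_def wdeg_def)
    have 2: "(\<Sum>i\<in>V. \<Sum>j\<in>V. d i * d j) = W\<^sup>2"
      by (simp add: sum_product[symmetric] dsum power2_eq_square)
    have 3: "(\<Sum>i\<in>V. \<Sum>j\<in>V. 2 / W * a i j) = 2"
      unfolding sum_distrib_left[symmetric] 1 using W by simp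
    have 4: "(\<Sum>i\<in>V. \<Sum>j\<in>V. d i * d j / W\<^sup>2) = 1"
      unfolding sum_divide_distrib[symmetric] 2 using W by simp
    show ?thesis
      by (simp only: sum.distrib sum_subtractf 3 4) simp
  qed
  also have "\<dots> = (\<Sum>j\<in>V. ((\<Sum>i\<in>V. (b j i)\<^sup>2 / d i) / 2) / d j)"
  proof -
    have "(a i j)\<^sup>2 / (d i * d j) - 2 / W * a i j + d i * d j / W\<^sup>2 = (b i j)\<^sup>2 / d j / d i"
      if "i \<in> V" "j \<in> V" for i j
      using dpos[OF that(1)] dpos[OF that(2)] W
      unfolding b_def by (simp add: field_simps power2_eq_square)
    then have "(\<Sum>i\<in>V. \<Sum>j\<in>V. (a i j)\<^sup>2 / (d i * d j) - 2 / W * a i j + d i * d j / W\<^sup>2)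
        = (\<Sum>i\<in>V. \<Sum>j\<in>V. (b i j)\<^sup>2 / d j / d i)"
      by (intro sum.cong) auto
    then show ?thesis by (simp add: sum_divide_distrib mult_ac)
  qed
  also have "\<dots> \<le> (\<Sum>j\<in>V. (\<Sum>i\<in>V. \<Sum>n\<in>V. b j i * b j n * g i n) / d j)"
    using green_form_ge[OF b0] pos dpos
    by (intro sum_mono divide_right_mono) (auto simp: d_def less_imp_le)
  also have "\<dots> = gtrace a V g - gmass a V g / vol a V - (real (card V) - 2)"
    using gtrace_gmass_excess[OF pos] by (simp add: b_def d_def W_def)
  finally show ?thesis unfolding d_def by linarith
qed

end

end

section \<open>Existence of the Green function\<close>

text \<open>Gaussian elimination with pivot \<open>p\<close>: the Schur complement \<open>M'\<close>
  is again symmetric and positive definite, and a solution for it extends to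
  \<open>p\<close>.\<close>

lemma positive_definite_solvable:
  fixes M :: "'a \<Rightarrow> 'a \<Rightarrow> real"
  assumes "finite S" and "\<And>i j. i \<in> S \<Longrightarrow> j \<in> S \<Longrightarrow> M i j = M j i"
    and "\<And>x. \<exists>i\<in>S. x i \<noteq> 0 \<Longrightarrow> (\<Sum>i\<in>S. \<Sum>j\<in>S. x i * M i j * x j) > 0"
  shows "\<exists>x. \<forall>i\<in>S. (\<Sum>j\<in>S. M i j * x j) = b i"
  using assms
proof (induction S arbitrary: M b rule: finite_induct)
  case (insert p S)
  note sym = insert.prems(1) and pd = insert.prems(2)
  have sum_upd: "(\<Sum>j\<in>S. f j ((x(p := c)) j)) = (\<Sum>j\<in>S. f j (x j))"
    for f and x :: "'a \<Rightarrow> real" and c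
    using insert.hyps by (intro sum.cong) auto
  define e :: "'a \<Rightarrow> real" where "e = (\<lambda>_. 0)(p := 1)"
  have Mpp: "M p p > 0"
  proof -
    have e: "e i = 0" if "i \<in> S" for i using insert.hyps that by (auto simp: e_def)
    have "(\<Sum>i\<in>insert p S. \<Sum>j\<in>insert p S. e i * M i j * e j) = M p p"
      using insert.hyps by (simp add: e) (simp add: e_def)
    then show ?thesis using pd[of e] by (auto simp: e_def)
  qed
  define M' where "M' = (\<lambda>i j. M i j - M i p * M p j / M p p)"
  define b' where "b' = (\<lambda>i. b i - M i p * b p / M p p)"
  have "\<exists>x. \<forall>i\<in>S. (\<Sum>j\<in>S. M' i j * x j) = b' i"
  proof (rule insert.IH)
    show "M' i j = M' j i" if "i \<in> S" "j \<in> S" for i j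
      unfolding M'_def using sym that by (simp add: mult.commute)
  next
    fix x :: "'a \<Rightarrow> real" assume x: "\<exists>i\<in>S. x i \<noteq> 0"
    \<comment> \<open>For given \<open>x\<close> this coordinate at \<open>p\<close> minimises the
      quadratic form of \<open>M\<close>; the minimum is the form of the Schur complement.\<close>
    define c where "c = - (\<Sum>j\<in>S. M p j * x j) / M p p"
    define y where "y = x(p := c)"
    have y: "y p = c" "\<And>j. j \<in> S \<Longrightarrow> y j = x j" using insert.hyps by (auto simp: y_def)
    have Mc: "(\<Sum>j\<in>S. M p j * x j) = - c * M p p" using Mpp by (simp add: c_def)
    have "0 < (\<Sum>i\<in>insert p S. \<Sum>j\<in>insert p S. y i * M i j * y j)"
      using x y(2) by (intro pd) auto
    also have "\<dots> = c * M p p * c + (\<Sum>j\<in>S. c * M p j * x j) +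
        (\<Sum>i\<in>S. x i * M i p * c + (\<Sum>j\<in>S. x i * M i j * x j))"
      using insert.hyps by (simp add: y)
    also have "(\<Sum>j\<in>S. c * M p j * x j) = - c * c * M p p"
      using Mc by (simp add: mult.assoc flip: sum_distrib_left)
    also have "(\<Sum>i\<in>S. x i * M i p * c + (\<Sum>j\<in>S. x i * M i j * x j)) =
        (\<Sum>i\<in>S. \<Sum>j\<in>S. x i * M' i j * x j)"
    proof (intro sum.cong refl)
      fix i assume "i \<in> S"
      have "(\<Sum>j\<in>S. x i * M' i j * x j) =
          (\<Sum>j\<in>S. x i * M i j * x j) - x i * M i p / M p p * (\<Sum>j\<in>S. M p j * x j)"
        unfolding M'_def sum_distrib_left sum_subtractf[symmetric]
        by (intro sum.cong refl) (simp add: algebra_simps)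
      then show "x i * M i p * c + (\<Sum>j\<in>S. x i * M i j * x j) = (\<Sum>j\<in>S. x i * M' i j * x j)"
        using Mpp by (simp add: Mc)
    qed
    finally show "0 < (\<Sum>i\<in>S. \<Sum>j\<in>S. x i * M' i j * x j)" by simp
  qed
  then obtain x where x: "\<And>i. i \<in> S \<Longrightarrow> (\<Sum>j\<in>S. M' i j * x j) = b' i" by blast
  define c where "c = (b p - (\<Sum>j\<in>S. M p j * x j)) / M p p"
  have Mc: "(\<Sum>j\<in>S. M p j * x j) = b p - c * M p p" using Mpp by (simp add: c_def)
  have "(\<Sum>j\<in>insert p S. M i j * (x(p := c)) j) = b i" if "i \<in> insert p S" for i
  proof -
    have eq: "(\<Sum>j\<in>insert p S. M i j * (x(p := c)) j) = M i p * c + (\<Sum>j\<in>S. M i j * x j)"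
      using insert.hyps sum_upd[of "\<lambda>j z. M i j * z" x c] by simp
    show ?thesis
    proof (cases "i = p")
      case True
      then show ?thesis using eq Mc by simp
    next
      case False
      then have "(\<Sum>j\<in>S. M' i j * x j) = b' i" using x that by simp
      moreover have "(\<Sum>j\<in>S. M' i j * x j) =
          (\<Sum>j\<in>S. M i j * x j) - M i p / M p p * (\<Sum>j\<in>S. M p j * x j)"
        unfolding M'_def sum_distrib_left sum_subtractf[symmetric]
        by (intro sum.cong refl) (simp add: algebra_simps)
      moreover have "M i p / M p p * (b p - c * M p p) = M i p * b p / M p p - M i p * c"
        using Mpp by (simp add: field_simps)
      ultimately show ?thesis
        unfolding eq b'_def Mc by linarith
    qed
  qed
  then show ?case by blast
qed simp

lemma sum_cut:
  fixes f :: "'a \<Rightarrow> real"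
  assumes "finite V1" "finite V2" "V1 \<inter> V2 = {v}" "f v = 0"
  shows "(\<Sum>i\<in>V1 \<union> V2. f i) = (\<Sum>i\<in>V1. f i) + (\<Sum>i\<in>V2. f i)"
  using sum.union_inter[OF assms(1,2), of f] assms by simp

context network
begin

text \<open>The form of the Laplacian with row and column \<open>v\<close> deleted is the energy of
  the extension by 0. Zero energy makes a function constant along edges, and \<open>conn\<close>,
  which encodes connectedness, then makes it 0.\<close>

lemma green_exists:
  assumes finV: "finite V" and v: "v \<in> V"
    and conn: "\<And>x i. x v = (0::real) \<Longrightarrow> (\<And>i j. i \<in> V \<Longrightarrow> j \<in> V \<Longrightarrow> a i j > 0 \<Longrightarrow> x i = x j)
      \<Longrightarrow> i \<in> V \<Longrightarrow> x i = 0"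
  shows "\<exists>g. green a V v g"
proof -
  define S where "S = V - {v}"
  have finS: "finite S" using finV by (simp add: S_def)
  define M where "M = (\<lambda>i j. wdeg a V i * of_bool (i = j) - a i j)"
  define ext where "ext = (\<lambda>x :: 'a \<Rightarrow> real. \<lambda>i. if i \<in> S then x i else 0)"
  have sumV: "(\<Sum>j\<in>V. f j * ext x j) = (\<Sum>j\<in>S. f j * x j)" for f x
    using finV v by (subst sum.remove[OF finV v]) (auto simp: S_def ext_def intro!: sum.cong)
  have lapM: "lap a V (ext x) i = (\<Sum>j\<in>S. M i j * x j)" if "i \<in> S" for i x
  proof -
    have "(\<Sum>j\<in>S. M i j * x j) = (\<Sum>j\<in>S. (wdeg a V i * x j) * of_bool (i = j)) - (\<Sum>j\<in>S. a i j * x j)"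
      unfolding M_def sum_subtractf[symmetric] by (intro sum.cong) (auto simp: algebra_simps)
    also have "(\<Sum>j\<in>S. (wdeg a V i * x j) * of_bool (i = j)) = wdeg a V i * x i"
      using finS that by (simp add: of_bool_def if_distrib cong: if_cong)
    finally show ?thesis using that by (simp add: lap_def sumV) (simp add: ext_def)
  qed
  have "\<exists>x. \<forall>i\<in>S. (\<Sum>k\<in>S. M i k * x k) = of_bool (i = j)" for j
  proof (rule positive_definite_solvable[OF finS])
    show "M i k = M k i" for i k by (auto simp: M_def a_sym)
  next
    fix x :: "'a \<Rightarrow> real" assume x: "\<exists>i\<in>S. x i \<noteq> 0"
    have eq: "(\<Sum>i\<in>S. \<Sum>j\<in>S. x i * M i j * x j) = energy a V (ext x) (ext x)"
    proof -
      have "energy a V (ext x) (ext x) = (\<Sum>i\<in>V. lap a V (ext x) i * ext x i)"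
        by (simp add: sum_lap[symmetric] mult.commute)
      also have "\<dots> = (\<Sum>i\<in>S. (\<Sum>j\<in>S. M i j * x j) * x i)"
        unfolding sumV using lapM by simp
      finally show ?thesis by (simp add: sum_distrib_right sum_distrib_left algebra_simps)
    qed
    have "energy a V (ext x) (ext x) \<noteq> 0"
    proof
      assume "energy a V (ext x) (ext x) = 0"
      then have "(\<Sum>i\<in>V. \<Sum>j\<in>V. a i j * (ext x i - ext x j) * (ext x i - ext x j)) = 0"
        by (simp add: energy_def)
      then have "a i j * (ext x i - ext x j) * (ext x i - ext x j) = 0" if "i \<in> V" "j \<in> V" for i j
        using that finV
        by (simp add: sum_nonneg_eq_0_iff sum_nonneg a_nonneg mult.assoc)
      then have "ext x i = ext x j" if "i \<in> V" "j \<in> V" "a i j > 0" for i j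
        using that by fastforce
      then have "ext x i = 0" if "i \<in> V" for i
        using conn[of "ext x" i] that by (simp add: ext_def S_def)
      moreover obtain i where "i \<in> S" "x i \<noteq> 0" using x by blast
      ultimately show False by (metis Diff_iff S_def ext_def)
    qed
    then show "0 < (\<Sum>i\<in>S. \<Sum>j\<in>S. x i * M i j * x j)"
      using energy_nonneg[of V "ext x"] by (simp add: eq)
  qed
  then obtain X where X: "\<And>i j. i \<in> S \<Longrightarrow> (\<Sum>k\<in>S. M i k * X j k) = of_bool (i = j)"
    by metis
  have "green a V v (\<lambda>i j. if j = v then 0 else ext (X j) i)"
    unfolding green_def
  proof (intro conjI ballI allI)
    fix i j assume "i \<in> V - {v}" "j \<in> V"
    then show "lap a V (\<lambda>n. if j = v then 0 else ext (X j) n) i = of_bool (i = j)"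
      using lapM[of i "X j"] X[of i j] by (cases "j = v") (auto simp: S_def lap_def[of _ _ "\<lambda>_. 0"])
  qed (simp_all add: ext_def S_def)
  then show ?thesis by blast
qed

context
  fixes V v g
  assumes finV: "finite V" and v: "v \<in> V" and g: "green a V v g"
begin

lemma lap_sum_green:
  assumes "i \<in> V"
  shows "lap a V (\<lambda>i. c + \<alpha> * g i j + (\<Sum>k\<in>V. \<beta> k * g i k)) i
    = \<alpha> * lap a V (\<lambda>n. g n j) i + \<beta> i - of_bool (i = v) * (\<Sum>k\<in>V. \<beta> k)"
proof -
  have "lap a V (\<lambda>i. c + \<alpha> * g i j + (\<Sum>k\<in>V. \<beta> k * g i k)) i
    = \<alpha> * lap a V (\<lambda>n. g n j) i + (\<Sum>k\<in>V. \<beta> k * lap a V (\<lambda>n. g n k) i)"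
  proof -
    have "(\<Sum>n\<in>V. a i n * (\<Sum>k\<in>V. \<beta> k * g n k)) = (\<Sum>k\<in>V. \<beta> k * (\<Sum>n\<in>V. a i n * g n k))"
      unfolding sum_distrib_left by (subst sum.swap) (simp add: algebra_simps)
    moreover have "(\<Sum>n\<in>V. a i n * (c + \<alpha> * g n j + (\<Sum>k\<in>V. \<beta> k * g n k))) =
       c * wdeg a V i + \<alpha> * (\<Sum>n\<in>V. a i n * g n j) + (\<Sum>n\<in>V. a i n * (\<Sum>k\<in>V. \<beta> k * g n k))"
      by (simp add: distrib_left sum.distrib wdeg_def sum_distrib_left mult_ac)
    ultimately show ?thesis
      by (simp add: lap_def right_diff_distrib distrib_left sum_subtractf sum_distrib_left mult_ac)
  qed
  also have "(\<Sum>k\<in>V. \<beta> k * lap a V (\<lambda>n. g n k) i)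
      = (\<Sum>k\<in>V. \<beta> k * of_bool (i = k)) - of_bool (i = v) * (\<Sum>k\<in>V. \<beta> k)"
    using assms by (simp add: green_lap[OF finV v g] right_diff_distrib sum_subtractf
        sum_distrib_left mult.commute)
  finally show ?thesis
    using assms by (simp add: sum_mult_of_bool[OF finV])
qed

text \<open>The potential \<open>x\<close> of the sources \<open>d\<close> is 0 at \<open>v\<close>
  and satisfies the first-step equation for hitting \<open>v\<close> elsewhere, so it is at least 1
  off \<open>v\<close>. Hence A is at least the sum of the degrees off \<open>v\<close>, which is
  half of the total or more because all weight at \<open>v\<close> leads to other vertices.\<close>

lemma gmass_ge_half_vol:
  assumes pos: "\<And>i. i \<in> V \<Longrightarrow> wdeg a V i > 0"
  shows "vol a V / 2 \<le> gmass a V g"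
proof -
  define d where "d = wdeg a V"
  define x where "x = (\<lambda>i. \<Sum>k\<in>V. d k * g i k)"
  have xv: "x v = 0" using green_v[OF finV v g] by (simp add: x_def)
  have x: "x i = 1 + (\<Sum>j\<in>V. a i j * x j) / d i" if "i \<in> V - {v}" for i
  proof -
    have "lap a V x i = d i"
      using lap_sum_green[of i 0 0 v d] that by (simp add: x_def)
    then show ?thesis using pos[of i] that by (simp add: lap_def d_def field_simps)
  qed
  have nonneg: "x i \<ge> 0" if "i \<in> V" for i
  proof -
    obtain p where p: "p \<in> V" "\<And>n. n \<in> V \<Longrightarrow> x p \<le> x n"
      using finV v by (metis arg_min_if_finite(1) arg_min_least empty_iff)
    have "p = v"
    proof (rule ccontr)
      assume "p \<noteq> v"
      have "d p * x p = (\<Sum>j\<in>V. a p j * x p)" by (simp add: d_def wdeg_def sum_distrib_right)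
      also have "\<dots> \<le> (\<Sum>j\<in>V. a p j * x j)"
        using p a_nonneg by (intro sum_mono mult_left_mono) auto
      finally have "x p \<le> (\<Sum>j\<in>V. a p j * x j) / d p"
        using pos[OF p(1)] by (simp add: d_def field_simps)
      then show False using x[of p] p \<open>p \<noteq> v\<close> by simp
    qed
    then show ?thesis using p that xv by metis
  qed
  have ge1: "x i \<ge> 1" if "i \<in> V - {v}" for i
  proof -
    have "(\<Sum>j\<in>V. a i j * x j) / d i \<ge> 0"
      using nonneg a_nonneg wdeg_nonneg by (auto simp: d_def intro!: divide_nonneg_nonneg sum_nonneg)
    then show ?thesis using x[OF that] by simp
  qed
  have split: "(\<Sum>i\<in>V. f i) = f v + (\<Sum>i\<in>V - {v}. f i)" for f :: "'a \<Rightarrow> real"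
    using sum.remove[OF finV v] .
  have "d v = (\<Sum>i\<in>V - {v}. a v i)"
    using split[of "a v"] by (simp add: d_def wdeg_def a_irrefl)
  also have "\<dots> \<le> (\<Sum>i\<in>V - {v}. d i)"
  proof (rule sum_mono)
    fix i assume "i \<in> V - {v}"
    show "a v i \<le> d i"
      unfolding d_def wdeg_def using member_le_sum[of v V "a i"] finV v a_nonneg a_sym[of v i] by simp
  qed
  finally have "vol a V / 2 \<le> (\<Sum>i\<in>V - {v}. d i)"
    using split[of d] by (simp add: vol_def d_def)
  also have "\<dots> \<le> (\<Sum>i\<in>V - {v}. d i * x i)"
  proof (rule sum_mono)
    fix i assume "i \<in> V - {v}"
    then show "d i \<le> d i * x i"
      using mult_left_mono[OF ge1, of i "d i"] wdeg_nonneg[of V i] by (simp add: d_def)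
  qed
  also have "\<dots> = gmass a V g"
  proof -
    have "gmass a V g = (\<Sum>i\<in>V. d i * x i)"
      by (simp add: gmass_def x_def d_def sum_distrib_left mult.assoc)
    then show ?thesis using split[of "\<lambda>i. d i * x i"] xv by simp
  qed
  finally show ?thesis .
qed

end

section \<open>Gluing two networks at a cut vertex\<close>

definition glue :: "'a set \<Rightarrow> 'a set \<Rightarrow> ('a \<Rightarrow> 'a \<Rightarrow> real) \<Rightarrow> ('a \<Rightarrow> 'a \<Rightarrow> real) \<Rightarrow> 'a \<Rightarrow> 'a \<Rightarrow> real" where
  "glue V1 V2 g1 g2 i j =
     (if i \<in> V1 \<and> j \<in> V1 then g1 i j else if i \<in> V2 \<and> j \<in> V2 then g2 i j else 0)"

context
  fixes V1 V2 :: "'a set" and v :: 'a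
  assumes fin: "finite V1" "finite V2" and cut: "V1 \<inter> V2 = {v}"
    and sep: "\<And>i j. i \<in> V1 - {v} \<Longrightarrow> j \<in> V2 - {v} \<Longrightarrow> a i j = 0"
begin

lemma cut_left:
  assumes "i \<in> V1 - {v}"
  shows "wdeg a (V1 \<union> V2) i = wdeg a V1 i" "lap a (V1 \<union> V2) x i = lap a V1 x i"
proof -
  have "(\<Sum>j\<in>V1 \<union> V2. a i j * x j) = (\<Sum>j\<in>V1. a i j * x j)" for x
    using fin assms cut by (intro sum.mono_neutral_right) (auto intro!: sep)
  from this[of "\<lambda>_. 1"] this[of x]
  show "wdeg a (V1 \<union> V2) i = wdeg a V1 i" "lap a (V1 \<union> V2) x i = lap a V1 x i"
    by (simp_all add: wdeg_def lap_def)
qed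

lemma cut_right:
  assumes "i \<in> V2 - {v}"
  shows "wdeg a (V1 \<union> V2) i = wdeg a V2 i" "lap a (V1 \<union> V2) x i = lap a V2 x i"
proof -
  have "a i j = 0" if "j \<in> V1 - V2" for j
    using sep[of j i] a_sym[of i j] assms cut that by auto
  then have "(\<Sum>j\<in>V1 \<union> V2. a i j * x j) = (\<Sum>j\<in>V2. a i j * x j)" for x
    using fin by (intro sum.mono_neutral_right) auto
  from this[of "\<lambda>_. 1"] this[of x]
  show "wdeg a (V1 \<union> V2) i = wdeg a V2 i" "lap a (V1 \<union> V2) x i = lap a V2 x i"
    by (simp_all add: wdeg_def lap_def)
qed

lemma lap_cong: "(\<And>j. j \<in> V \<Longrightarrow> x j = y j) \<Longrightarrow> i \<in> V \<Longrightarrow> lap a V x i = lap a V y i"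
  by (simp add: lap_def)

lemma vol_cut: "vol a (V1 \<union> V2) = vol a V1 + vol a V2"
proof -
  have vV: "v \<in> V1" "v \<in> V2" using cut by auto
  have "vol a (V1 \<union> V2) = wdeg a (V1 \<union> V2) v + (\<Sum>i\<in>V1 - {v}. wdeg a (V1 \<union> V2) i)
      + (\<Sum>i\<in>V2 - {v}. wdeg a (V1 \<union> V2) i)"
  proof -
    have "V1 \<union> V2 = insert v ((V1 - {v}) \<union> (V2 - {v}))" "(V1 - {v}) \<inter> (V2 - {v}) = {}"
      using cut by auto
    then show ?thesis
      unfolding vol_def using fin by (simp add: sum.union_disjoint)
  qed
  also have "wdeg a (V1 \<union> V2) v = wdeg a V1 v + wdeg a V2 v"
    unfolding wdeg_def by (rule sum_cut[OF fin cut]) (simp add: a_irrefl)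
  finally show ?thesis
    using sum.remove[OF fin(1), of v "wdeg a V1"] sum.remove[OF fin(2), of v "wdeg a V2"] vV
    by (simp add: cut_left cut_right vol_def)
qed

context
  fixes g1 g2
  assumes g1: "green a V1 v g1" and g2: "green a V2 v g2"
begin

lemma glue_simps:
  "i \<in> V1 \<Longrightarrow> j \<in> V1 \<Longrightarrow> glue V1 V2 g1 g2 i j = g1 i j"
  "i \<in> V2 \<Longrightarrow> j \<in> V2 \<Longrightarrow> glue V1 V2 g1 g2 i j = g2 i j"
  "i \<in> V1 \<Longrightarrow> j \<in> V2 \<Longrightarrow> glue V1 V2 g1 g2 i j = 0"
  "i \<in> V2 \<Longrightarrow> j \<in> V1 \<Longrightarrow> glue V1 V2 g1 g2 i j = 0"
  "glue V1 V2 g1 g2 v i = 0" "glue V1 V2 g1 g2 i v = 0"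
proof -
  have "i = v" if "i \<in> V1" "i \<in> V2" for i using cut that by auto
  then show "i \<in> V1 \<Longrightarrow> j \<in> V1 \<Longrightarrow> glue V1 V2 g1 g2 i j = g1 i j"
    "i \<in> V2 \<Longrightarrow> j \<in> V2 \<Longrightarrow> glue V1 V2 g1 g2 i j = g2 i j"
    "i \<in> V1 \<Longrightarrow> j \<in> V2 \<Longrightarrow> glue V1 V2 g1 g2 i j = 0"
    "i \<in> V2 \<Longrightarrow> j \<in> V1 \<Longrightarrow> glue V1 V2 g1 g2 i j = 0"
    "glue V1 V2 g1 g2 v i = 0" "glue V1 V2 g1 g2 i v = 0"
    using g1 g2 by (auto simp: glue_def green_def)
qed

text \<open>Grounding \<open>v\<close> decouples the sides: off \<open>v\<close> the Laplacian of
  the union sees one side only, and a column belonging to the other side vanishes there.\<close>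

lemma green_glue: "green a (V1 \<union> V2) v (glue V1 V2 g1 g2)"
  unfolding green_def
proof (intro conjI allI ballI)
  fix i j assume i: "i \<in> V1 \<union> V2 - {v}" and j: "j \<in> V1 \<union> V2"
  have zero: "lap a V (\<lambda>_. 0) i = 0" for V by (simp add: lap_def)
  have disj: "i \<in> V1 \<Longrightarrow> i \<in> V2 \<Longrightarrow> False" using i cut by auto
  show "lap a (V1 \<union> V2) (\<lambda>n. glue V1 V2 g1 g2 n j) i = of_bool (i = j)"
  proof (cases "i \<in> V1")
    case True
    then have eq: "lap a (V1 \<union> V2) (\<lambda>n. glue V1 V2 g1 g2 n j) i = lap a V1 (\<lambda>n. glue V1 V2 g1 g2 n j) i"
      using i by (simp add: cut_left)
    show ?thesis
    proof (cases "j \<in> V1")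
      case jV: True
      have "lap a V1 (\<lambda>n. glue V1 V2 g1 g2 n j) i = lap a V1 (\<lambda>n. g1 n j) i"
        using jV True by (intro lap_cong) (simp_all add: glue_simps)
      then show ?thesis using eq g1 True i jV by (simp add: green_def)
    next
      case jV: False
      then have "lap a V1 (\<lambda>n. glue V1 V2 g1 g2 n j) i = lap a V1 (\<lambda>_. 0) i"
        using j True by (intro lap_cong) (auto simp: glue_simps)
      then show ?thesis using eq jV True zero by auto
    qed
  next
    case False
    then have iV: "i \<in> V2" using i by simp
    then have eq: "lap a (V1 \<union> V2) (\<lambda>n. glue V1 V2 g1 g2 n j) i = lap a V2 (\<lambda>n. glue V1 V2 g1 g2 n j) i"
      using i by (simp add: cut_right)
    show ?thesis
    proof (cases "j \<in> V2")
      case jV: True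
      have "lap a V2 (\<lambda>n. glue V1 V2 g1 g2 n j) i = lap a V2 (\<lambda>n. g2 n j) i"
        using jV iV by (intro lap_cong) (simp_all add: glue_simps)
      then show ?thesis using eq g2 iV i jV by (simp add: green_def)
    next
      case jV: False
      then have "lap a V2 (\<lambda>n. glue V1 V2 g1 g2 n j) i = lap a V2 (\<lambda>_. 0) i"
        using j iV by (intro lap_cong) (auto simp: glue_simps)
      then show ?thesis using eq jV iV zero by auto
    qed
  qed
qed (simp_all add: glue_simps)

text \<open>Only the degree of \<open>v\<close> changes under gluing, and it is always multiplied by
  an entry of the Green function that is 0. The same holds for \<open>gmass\<close>.\<close>

lemma gtrace_glue: "gtrace a (V1 \<union> V2) (glue V1 V2 g1 g2) = gtrace a V1 g1 + gtrace a V2 g2"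
proof -
  let ?f = "\<lambda>i. wdeg a (V1 \<union> V2) i * glue V1 V2 g1 g2 i i"
  have "?f i = wdeg a V1 i * g1 i i" if "i \<in> V1" for i
    using that g1 by (cases "i = v") (auto simp: glue_simps cut_left green_def)
  then have "(\<Sum>i\<in>V1. ?f i) = gtrace a V1 g1" by (simp only: gtrace_def cong: sum.cong)
  moreover have "?f i = wdeg a V2 i * g2 i i" if "i \<in> V2" for i
    using that g2 by (cases "i = v") (auto simp: glue_simps cut_right green_def)
  then have "(\<Sum>i\<in>V2. ?f i) = gtrace a V2 g2" by (simp only: gtrace_def cong: sum.cong)
  moreover have "(\<Sum>i\<in>V1 \<union> V2. ?f i) = (\<Sum>i\<in>V1. ?f i) + (\<Sum>i\<in>V2. ?f i)"
    by (rule sum_cut[OF fin cut]) (simp add: glue_simps)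
  ultimately show ?thesis by (simp only: gtrace_def)
qed

lemma gmass_glue: "gmass a (V1 \<union> V2) (glue V1 V2 g1 g2) = gmass a V1 g1 + gmass a V2 g2"
proof -
  let ?f = "\<lambda>i j. wdeg a (V1 \<union> V2) i * wdeg a (V1 \<union> V2) j * glue V1 V2 g1 g2 i j"
  have cutf: "(\<Sum>j\<in>V1 \<union> V2. ?f i j) = (\<Sum>j\<in>V1. ?f i j) + (\<Sum>j\<in>V2. ?f i j)" for i
    by (rule sum_cut[OF fin cut]) (simp add: glue_simps)
  have "?f i j = wdeg a V1 i * wdeg a V1 j * g1 i j" if "i \<in> V1" "j \<in> V1" for i j
    using that g1 by (cases "i = v"; cases "j = v") (auto simp: glue_simps cut_left green_def)
  moreover have "(\<Sum>j\<in>V2. ?f i j) = 0" if "i \<in> V1" for i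
    using that by (intro sum.neutral) (auto simp: glue_simps)
  ultimately have "(\<Sum>j\<in>V1 \<union> V2. ?f i j) = (\<Sum>j\<in>V1. wdeg a V1 i * wdeg a V1 j * g1 i j)"
    if "i \<in> V1" for i
    using that by (simp only: cutf add_0_right cong: sum.cong)
  then have 1: "(\<Sum>i\<in>V1. \<Sum>j\<in>V1 \<union> V2. ?f i j) = gmass a V1 g1"
    by (simp only: gmass_def cong: sum.cong)
  have "?f i j = wdeg a V2 i * wdeg a V2 j * g2 i j" if "i \<in> V2" "j \<in> V2" for i j
    using that g2 by (cases "i = v"; cases "j = v") (auto simp: glue_simps cut_right green_def)
  moreover have "(\<Sum>j\<in>V1. ?f i j) = 0" if "i \<in> V2" for i
    using that by (intro sum.neutral) (auto simp: glue_simps)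
  ultimately have "(\<Sum>j\<in>V1 \<union> V2. ?f i j) = (\<Sum>j\<in>V2. wdeg a V2 i * wdeg a V2 j * g2 i j)"
    if "i \<in> V2" for i
    using that by (simp only: cutf add_0_left cong: sum.cong)
  then have 2: "(\<Sum>i\<in>V2. \<Sum>j\<in>V1 \<union> V2. ?f i j) = gmass a V2 g2"
    by (simp only: gmass_def cong: sum.cong)
  have "(\<Sum>i\<in>V1 \<union> V2. \<Sum>j\<in>V1 \<union> V2. ?f i j)
      = (\<Sum>i\<in>V1. \<Sum>j\<in>V1 \<union> V2. ?f i j) + (\<Sum>i\<in>V2. \<Sum>j\<in>V1 \<union> V2. ?f i j)"
    by (rule sum_cut[OF fin cut]) (simp add: glue_simps)
  then show ?thesis unfolding 1 2 by (simp only: gmass_def)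
qed

end
end

end

section \<open>Kemeny's constant\<close>

definition adj :: "'a set set \<Rightarrow> 'a \<Rightarrow> 'a \<Rightarrow> real" where
  "adj E i j = of_bool ({i, j} \<in> E)"

lemma network_adj:
  assumes "\<And>e. e \<in> E \<Longrightarrow> card e = 2"
  shows "network (adj E)"
  using assms[of "{i}" for i] by unfold_locales (auto simp: adj_def insert_commute)

lemma sum_nbrs:
  assumes "finite (verts G)"
  shows "(\<Sum>n\<in>nbrs G i. f n) = (\<Sum>n\<in>verts G. adj (edges G) i n * f n)"
proof -
  have "(\<Sum>n\<in>verts G. adj (edges G) i n * f n)
      = (\<Sum>n\<in>verts G. if {i, n} \<in> edges G then f n else 0)"
    by (intro sum.cong) (auto simp: adj_def)
  also have "\<dots> = (\<Sum>n\<in>nbrs G i. f n)"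
    using assms by (simp add: nbrs_def sum.inter_filter)
  finally show ?thesis by simp
qed

lemma wdeg_adj:
  assumes "finite (verts G)"
  shows "wdeg (adj (edges G)) (verts G) i = real (deg G i)"
  using sum_nbrs[OF assms, of "\<lambda>_. 1" i] by (simp add: wdeg_def deg_def)

text \<open>Each edge inside \<open>S\<close> arises from exactly two ordered pairs; the entries are
  expanded into indicators over the edges and the summations exchanged.\<close>

lemma sum_adj:
  assumes fin: "finite S" and E: "\<And>e. e \<in> E \<Longrightarrow> card e = 2"
  shows "(\<Sum>i\<in>S. \<Sum>j\<in>S. adj E i j) = 2 * real (card {e \<in> E. e \<subseteq> S})"
proof -
  let ?F = "{e \<in> E. e \<subseteq> S}"
  have finF: "finite ?F" using fin by (rule_tac finite_subset[of _ "Pow S"]) auto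
  have "(\<Sum>i\<in>S. \<Sum>j\<in>S. adj E i j) = (\<Sum>i\<in>S. \<Sum>j\<in>S. \<Sum>e\<in>?F. of_bool ({i, j} = e) * 1)"
  proof (intro sum.cong refl)
    fix i j assume ij: "i \<in> S" "j \<in> S"
    show "adj E i j = (\<Sum>e\<in>?F. of_bool ({i, j} = e) * 1)"
    proof (cases "{i, j} \<in> ?F")
      case True
      then show ?thesis using sum_mult_of_bool(2)[OF finF True, of "\<lambda>_. 1"] by (simp add: adj_def)
    next
      case False
      then have "(\<Sum>e\<in>?F. of_bool ({i, j} = e) * 1) = (0::real)" by (intro sum.neutral) auto
      then show ?thesis using False ij by (simp add: adj_def)
    qed
  qed
  also have "\<dots> = (\<Sum>i\<in>S. \<Sum>e\<in>?F. \<Sum>j\<in>S. of_bool ({i, j} = e))"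
    by (simp add: sum.swap[of _ ?F])
  also have "\<dots> = (\<Sum>e\<in>?F. \<Sum>i\<in>S. \<Sum>j\<in>S. of_bool ({i, j} = e))"
    by (rule sum.swap)
  also have "\<dots> = (\<Sum>e\<in>?F. 2)"
  proof (intro sum.cong refl)
    fix e assume e: "e \<in> ?F"
    then obtain p q where pq: "e = {p, q}" "p \<noteq> q" using E[of e] by (auto simp: card_2_iff)
    then have in_S: "p \<in> S" "q \<in> S" using e by auto
    have "of_bool ({i, j} = e) = of_bool (i = p) * of_bool (j = q) + of_bool (i = q) * (of_bool (j = p) :: real)"
      for i j using pq by (auto simp: doubleton_eq_iff)
    then have "(\<Sum>i\<in>S. \<Sum>j\<in>S. of_bool ({i, j} = e)) =
        (\<Sum>i\<in>S. of_bool (i = p) * (\<Sum>j\<in>S. of_bool (j = q) * 1)) +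
        (\<Sum>i\<in>S. of_bool (i = q) * (\<Sum>j\<in>S. of_bool (j = p) * (1::real)))"
      by (simp add: sum.distrib sum_distrib_left)
    then show "(\<Sum>i\<in>S. \<Sum>j\<in>S. of_bool ({i, j} = e)) = (2::real)"
      using in_S fin by (simp only: sum_mult_of_bool)
  qed
  finally show ?thesis by simp
qed

lemma vol_adj:
  assumes "finite S" "\<And>e. e \<in> E \<Longrightarrow> card e = 2"
  shows "vol (adj E) S = 2 * real (card {e \<in> E. e \<subseteq> S})"
  using sum_adj[OF assms] by (simp add: vol_def wdeg_def)

lemma kemeny_green:
  assumes G: "simple_graph G" and ne: "\<And>i. i \<in> verts G \<Longrightarrow> nbrs G i \<noteq> {}"
    and v: "v \<in> verts G" and g: "green (adj (edges G)) (verts G) v g"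
  shows "kemeny G = gtrace (adj (edges G)) (verts G) g -
    gmass (adj (edges G)) (verts G) g / vol (adj (edges G)) (verts G)"
proof -
  define V where "V = verts G"
  define a where "a = adj (edges G)"
  have fin: "finite V" and E: "\<And>e. e \<in> edges G \<Longrightarrow> card e = 2 \<and> e \<subseteq> V"
    using G by (auto simp: simple_graph_def V_def)
  interpret network a unfolding a_def using E by (intro network_adj) auto
  note g' = fin v[folded V_def] g[folded V_def a_def]
  define d where "d = (\<lambda>i. real (deg G i))"
  have wdeg: "wdeg a V i = d i" for i using wdeg_adj fin by (simp add: a_def V_def d_def)
  define W where "W = vol a V"
  have W_sum: "W = (\<Sum>i\<in>V. d i)" by (simp add: W_def vol_def wdeg)
  have dpos: "d i > 0" if "i \<in> V" for i
    using ne[of i] that fin by (auto simp: d_def deg_def card_gt_0_iff V_def nbrs_def)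
  have Wpos: "W > 0" unfolding W_sum using fin v dpos by (intro sum_pos) (auto simp: V_def)
  have W_card: "2 * real (card (edges G)) = W"
  proof -
    have "{e \<in> edges G. e \<subseteq> V} = edges G" using E by auto
    then show ?thesis using vol_adj[of V "edges G"] fin E by (simp add: W_def a_def)
  qed
  \<comment> \<open>As functions of \<open>i\<close>, the column term has Laplacian -W at
    \<open>j\<close> and +W at \<open>v\<close>, and the potential of the degrees has
    \<open>d\<close> with W subtracted at \<open>v\<close>. Together they give \<open>d\<close> off
    \<open>j\<close>, which is the first-step equation; the terms without \<open>i\<close> make
    \<open>h j j\<close> vanish.\<close>
  define h where "h = (\<lambda>j i. W * (g j j - g i j) + (\<Sum>k\<in>V. d k * (g i k - g j k)))"
  have hit: "hitting_time G i j = h j i" if "i \<in> V" "j \<in> V" for i j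
  proof (rule hitting_time_eqI)
    fix i assume i: "i \<in> verts G" "i \<noteq> j"
    have "h j = (\<lambda>i. (W * g j j - (\<Sum>k\<in>V. d k * g j k)) + (- W) * g i j + (\<Sum>k\<in>V. d k * g i k))"
      by (simp add: h_def fun_eq_iff algebra_simps sum_subtractf)
    then have "lap a V (h j) i = (- W) * lap a V (\<lambda>n. g n j) i + d i - of_bool (i = v) * W"
      using lap_sum_green[OF g', of i "W * g j j - (\<Sum>k\<in>V. d k * g j k)" "- W" j d] i
      by (simp add: W_sum V_def)
    also have "\<dots> = d i"
      using green_lap[OF g', of i j] i that by (simp add: V_def)
    finally have "d i * h j i - (\<Sum>n\<in>nbrs G i. h j n) = d i"
      using sum_nbrs[of G "h j" i] fin by (simp add: lap_def wdeg[unfolded V_def a_def] V_def a_def)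
    then show "h j i = 1 + (\<Sum>n\<in>nbrs G i. h j n) / real (deg G i)"
      using dpos[of i] i by (simp add: V_def d_def field_simps)
  qed (use that fin ne in \<open>simp_all add: V_def h_def\<close>)
  have main: "(\<Sum>j\<in>verts G. stationary G j * hitting_time G i j) = gtrace a V g - gmass a V g / W"
    if i: "i \<in> V" for i
  proof -
    have "(\<Sum>j\<in>verts G. stationary G j * hitting_time G i j) = (\<Sum>j\<in>V. d j / W * h j i)"
      using i by (intro sum.cong) (auto simp: stationary_def W_card hit d_def V_def[symmetric])
    also have "\<dots> = (\<Sum>j\<in>V. d j * g j j - d j * g i j + d j * ((\<Sum>k\<in>V. d k * g i k) / W)
        - (\<Sum>k\<in>V. d j * d k * g j k) / W)"
    proof (intro sum.cong refl)
      fix j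
      have "d j / W * h j i = d j / W * (W * g j j - W * g i j + (\<Sum>k\<in>V. d k * g i k) - (\<Sum>k\<in>V. d k * g j k))"
        by (simp add: h_def algebra_simps sum_subtractf)
      also have "\<dots> = d j * g j j - d j * g i j + d j * ((\<Sum>k\<in>V. d k * g i k) / W)
        - d j * (\<Sum>k\<in>V. d k * g j k) / W"
        using Wpos by (simp add: field_simps)
      finally show "d j / W * h j i = d j * g j j - d j * g i j + d j * ((\<Sum>k\<in>V. d k * g i k) / W)
        - (\<Sum>k\<in>V. d j * d k * g j k) / W" by (simp add: sum_distrib_left mult.assoc)
    qed
    \<comment> \<open>The two terms containing \<open>i\<close> cancel, so the average has one value
      for all starting vertices.\<close>
    also have "\<dots> = gtrace a V g - (\<Sum>j\<in>V. d j * g i j) + W * ((\<Sum>k\<in>V. d k * g i k) / W) - gmass a V g / W"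
      by (simp add: sum.distrib sum_subtractf gtrace_def gmass_def wdeg W_sum sum_distrib_right
          sum_divide_distrib)
    finally show ?thesis using Wpos by simp
  qed
  show ?thesis
    unfolding kemeny_def
  proof (rule the_equality)
    show "\<forall>i\<in>verts G. gtrace (adj (edges G)) (verts G) g -
      gmass (adj (edges G)) (verts G) g / vol (adj (edges G)) (verts G) =
      (\<Sum>j\<in>verts G. stationary G j * hitting_time G i j)"
      using main by (simp add: W_def V_def a_def)
  next
    fix K assume "\<forall>i\<in>verts G. K = (\<Sum>j\<in>verts G. stationary G j * hitting_time G i j)"
    then show "K = gtrace (adj (edges G)) (verts G) g -
      gmass (adj (edges G)) (verts G) g / vol (adj (edges G)) (verts G)"
      using main[of v] v by (simp add: W_def V_def a_def)
  qed
qed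

lemma weights_cong:
  assumes "\<And>i j. i \<in> V \<Longrightarrow> j \<in> V \<Longrightarrow> a i j = b i j"
  shows "vol a V = vol b V" "green a V v g = green b V v g"
    "gtrace a V g = gtrace b V g" "gmass a V g = gmass b V g"
proof -
  have wdeg: "wdeg a V i = wdeg b V i" if "i \<in> V" for i
    using assms that by (simp add: wdeg_def)
  then have lap: "lap a V x i = lap b V x i" if "i \<in> V" for i x
    using assms that by (simp add: lap_def)
  show "vol a V = vol b V" "green a V v g = green b V v g"
    "gtrace a V g = gtrace b V g" "gmass a V g = gmass b V g"
    using wdeg lap by (simp_all add: vol_def green_def gtrace_def gmass_def)
qed

lemma vol_simple_graph:
  assumes "simple_graph G"
  shows "vol (adj (edges G)) (verts G) = 2 * real (card (edges G))"
proof -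
  have "{e \<in> edges G. e \<subseteq> verts G} = edges G" using assms by (auto simp: simple_graph_def)
  then show ?thesis using vol_adj[of "verts G" "edges G"] assms by (simp add: simple_graph_def)
qed

text \<open>An edge of one graph with both ends in the other would be a loop at \<open>v\<close>, so
  the weights restrict correctly and \<open>glue\<close> applies. The two graphs interact only
  through the common denominator.\<close>

lemma kemeny_graph_union:
  assumes G1: "simple_graph G1" and G2: "simple_graph G2" and cut: "verts G1 \<inter> verts G2 = {v}"
    and ne1: "\<And>i. i \<in> verts G1 \<Longrightarrow> nbrs G1 i \<noteq> {}"
    and ne2: "\<And>i. i \<in> verts G2 \<Longrightarrow> nbrs G2 i \<noteq> {}"
    and g1: "green (adj (edges G1)) (verts G1) v g1"
    and g2: "green (adj (edges G2)) (verts G2) v g2"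
  shows "kemeny (graph_union G1 G2) =
    gtrace (adj (edges G1)) (verts G1) g1 + gtrace (adj (edges G2)) (verts G2) g2 -
    (gmass (adj (edges G1)) (verts G1) g1 + gmass (adj (edges G2)) (verts G2) g2) /
    (2 * (real (card (edges G1)) + real (card (edges G2))))"
proof -
  let ?G = "graph_union G1 G2" and ?V1 = "verts G1" and ?V2 = "verts G2"
  let ?a = "adj (edges ?G)"
  have verts: "verts ?G = ?V1 \<union> ?V2" and edges: "edges ?G = edges G1 \<union> edges G2"
    by (simp_all add: graph_union_def)
  have sG: "simple_graph ?G"
    using G1 G2 by (auto simp: simple_graph_def graph_union_def)
  interpret network ?a using sG by (intro network_adj) (auto simp: simple_graph_def)
  have fin: "finite ?V1" "finite ?V2" using G1 G2 by (auto simp: simple_graph_def)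
  have E1: "e \<subseteq> ?V1 \<and> card e = 2" if "e \<in> edges G1" for e
    using G1 that by (simp add: simple_graph_def)
  have E2: "e \<subseteq> ?V2 \<and> card e = 2" if "e \<in> edges G2" for e
    using G2 that by (simp add: simple_graph_def)
  have loop: "{i} \<notin> edges G1" "{i} \<notin> edges G2" for i
    using E1[of "{i}"] E2[of "{i}"] by auto
  have a1: "?a i j = adj (edges G1) i j" if "i \<in> ?V1" "j \<in> ?V1" for i j
  proof -
    have "{i, j} \<notin> edges G2"
    proof
      assume *: "{i, j} \<in> edges G2"
      then have "i = v" "j = v" using E2[OF *] that cut by auto
      then show False using * loop by simp
    qed
    then show ?thesis by (simp add: adj_def edges)
  qed
  have a2: "?a i j = adj (edges G2) i j" if "i \<in> ?V2" "j \<in> ?V2" for i j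
  proof -
    have "{i, j} \<notin> edges G1"
    proof
      assume *: "{i, j} \<in> edges G1"
      then have "i = v" "j = v" using E1[OF *] that cut by auto
      then show False using * loop by simp
    qed
    then show ?thesis by (simp add: adj_def edges)
  qed
  have sep: "?a i j = 0" if "i \<in> ?V1 - {v}" "j \<in> ?V2 - {v}" for i j
    using that cut E1[of "{i, j}"] E2[of "{i, j}"] by (auto simp: adj_def edges)
  have w1: "vol ?a ?V1 = vol (adj (edges G1)) ?V1" "green ?a ?V1 v g = green (adj (edges G1)) ?V1 v g"
    "gtrace ?a ?V1 g = gtrace (adj (edges G1)) ?V1 g" "gmass ?a ?V1 g = gmass (adj (edges G1)) ?V1 g" for g
    by (rule weights_cong; simp add: a1)+
  have w2: "vol ?a ?V2 = vol (adj (edges G2)) ?V2" "green ?a ?V2 v g = green (adj (edges G2)) ?V2 v g"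
    "gtrace ?a ?V2 g = gtrace (adj (edges G2)) ?V2 g" "gmass ?a ?V2 g = gmass (adj (edges G2)) ?V2 g" for g
    by (rule weights_cong; simp add: a2)+
  have g1': "green ?a ?V1 v g1" and g2': "green ?a ?V2 v g2"
    using g1 g2 by (simp_all add: w1 w2)
  let ?g = "glue ?V1 ?V2 g1 g2"
  have ne: "nbrs ?G i \<noteq> {}" if "i \<in> verts ?G" for i
    using that ne1[of i] ne2[of i] unfolding verts by (auto simp: nbrs_def graph_union_def)
  have "green ?a (verts ?G) v ?g"
    unfolding verts by (rule green_glue[OF fin cut _ g1' g2']) (rule sep)
  moreover have "v \<in> verts ?G" using cut verts by auto
  ultimately have "kemeny ?G = gtrace ?a (verts ?G) ?g - gmass ?a (verts ?G) ?g / vol ?a (verts ?G)"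
    by (intro kemeny_green[OF sG ne])
  also have "gtrace ?a (verts ?G) ?g = gtrace ?a ?V1 g1 + gtrace ?a ?V2 g2"
    unfolding verts by (rule gtrace_glue[OF fin cut _ g1' g2']) (rule sep)
  also have "gmass ?a (verts ?G) ?g = gmass ?a ?V1 g1 + gmass ?a ?V2 g2"
    unfolding verts by (rule gmass_glue[OF fin cut _ g1' g2']) (rule sep)
  also have "vol ?a (verts ?G) = vol ?a ?V1 + vol ?a ?V2"
    unfolding verts by (rule vol_cut[OF fin cut]) (rule sep)
  finally show ?thesis
    using vol_simple_graph[OF G1] vol_simple_graph[OF G2] by (simp add: w1 w2 distrib_left)
qed

lemma green_exists_connected:
  assumes G: "simple_graph G" "connected_graph G" and v: "v \<in> verts G"
  shows "\<exists>g. green (adj (edges G)) (verts G) v g"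
proof -
  interpret network "adj (edges G)" using G by (intro network_adj) (auto simp: simple_graph_def)
  show ?thesis
  proof (rule green_exists[OF _ v])
    show "finite (verts G)" using G by (simp add: simple_graph_def)
  next
    fix x :: "'a \<Rightarrow> real" and i
    assume x: "x v = 0" "\<And>i j. i \<in> verts G \<Longrightarrow> j \<in> verts G \<Longrightarrow> adj (edges G) i j > 0 \<Longrightarrow> x i = x j"
      and i: "i \<in> verts G"
    have "(v, i) \<in> {(x, y). {x, y} \<in> edges G}\<^sup>*" using G(2) v i by (auto simp: connected_graph_def)
    then show "x i = 0"
    proof induction
      case (step y z)
      then have "y \<in> verts G" "z \<in> verts G" "adj (edges G) y z > 0"
        using G(1) by (auto simp: simple_graph_def adj_def)
      then show ?case using x(2)[of y z] step.IH by simp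
    qed (rule x)
  qed
qed

lemma connected_nbrs_nonempty:
  assumes G: "simple_graph G" "connected_graph G" and "edges G \<noteq> {}" and i: "i \<in> verts G"
  shows "nbrs G i \<noteq> {}"
proof -
  obtain e where "e \<in> edges G" using assms by blast
  then have "e \<subseteq> verts G" "card e = 2" using G(1) by (simp_all add: simple_graph_def)
  then obtain w where "w \<in> verts G" "w \<noteq> i" unfolding card_2_iff by auto
  then have "(i, w) \<in> {(x, y). {x, y} \<in> edges G}\<^sup>*" using G(2) i by (auto simp: connected_graph_def)
  then obtain y where "{i, y} \<in> edges G" using \<open>w \<noteq> i\<close> by (auto elim: converse_rtranclE)
  then have "y \<in> nbrs G i" using G(1) by (auto simp: nbrs_def simple_graph_def)
  then show ?thesis by blast
qed

section \<open>Networks with a hub\<close>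

text \<open>Expand (x - \<theta> y)^2 / y \<ge> 0. Summed with a common \<theta>, this yields
  Cauchy-Schwarz for sums of quotients x^2 / y.\<close>

lemma quotient_ge_tangent:
  fixes x y \<theta> :: real
  assumes "y > 0"
  shows "2 * \<theta> * x - \<theta>\<^sup>2 * y \<le> x\<^sup>2 / y"
proof -
  have "0 \<le> (x - \<theta> * y)\<^sup>2 / y" using assms by simp
  also have "\<dots> = x\<^sup>2 / y - (2 * \<theta> * x - \<theta>\<^sup>2 * y)"
    using assms by (simp add: field_simps power2_eq_square)
  finally show ?thesis by simp
qed

text \<open>Here \<tau> stands for T - k. The last hypothesis bounds \<open>A\<close> by 2 (k + l)
  \<tau> + k + l + 2 l (k + l) / (k + 2 l), so the fraction has to be less than 2 m \<tau>.\<close>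

lemma hub_arith:
  fixes k l m \<tau> A :: real
  assumes k: "k \<ge> 2" and l: "l \<ge> k - 1"
    and m: "l \<ge> k \<Longrightarrow> 2 * m \<ge> k" "l < k \<Longrightarrow> 2 * m \<ge> l + 2"
    and \<tau>: "\<tau> \<ge> (2 * l)\<^sup>2 / (k * (2 * l + k - 1))"
    and A: "k - 1 + k / (k + 2 * l) / 2 \<le> k + \<tau> - A / (2 * (k + l))"
  shows "A < 2 * (m + k + l) * \<tau> + k + l"
proof -
  have l1: "l \<ge> 1" using k l by simp
  have m0: "m > 0" using m k l1 by (cases "l \<ge> k") auto
  \<comment> \<open>This is the bound on the fraction with the lower estimate of \<tau> inserted and
    denominators cleared.\<close>
  have "k * (k + l) * (2 * l + k - 1) < 4 * m * l * (k + 2 * l)"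
  proof (cases "l \<ge> k")
    case True
    have "k * ((k + l) * (2 * l + k - 1)) < k * (2 * l * (k + 2 * l))"
    proof (rule mult_strict_left_mono)
      have "k * k + k * l \<le> l * l + l * l"
        using True k by (intro add_mono mult_mono) auto
      then show "(k + l) * (2 * l + k - 1) < 2 * l * (k + 2 * l)"
        using k l1 by (simp add: algebra_simps)
    qed (use k in simp)
    also have "\<dots> \<le> (2 * m) * (2 * l * (k + 2 * l))"
      using m(1) True k l1 by (intro mult_right_mono) auto
    finally show ?thesis by (simp add: algebra_simps)
  next
    case False
    \<comment> \<open>Here 2 m \<ge> l + 2 \<ge> k + 1. In terms of the slack \<open>t\<close> the
      difference of the two sides is a sum of nonnegative terms.\<close>
    define t where "t = l - (k - 1)"
    have t: "0 \<le> t" and lt: "l = k - 1 + t" using l by (auto simp: t_def)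
    have "k * (k + l) * (2 * l + k - 1) < (k + 1) * (2 * l * (k + 2 * l))"
    proof -
      have "(k + 1) * (2 * l * (k + 2 * l)) - k * (k + l) * (2 * l + k - 1) =
         2 * k * t\<^sup>2 + 4 * t\<^sup>2 + t * (3 * k\<^sup>2 + 7 * k - 8) + (k - 1) * (5 * k - 4)"
        unfolding lt by (simp add: algebra_simps power2_eq_square)
      moreover have "t * (3 * k\<^sup>2 + 7 * k - 8) \<ge> 0"
      proof (intro mult_nonneg_nonneg t)
        show "0 \<le> 3 * k\<^sup>2 + 7 * k - 8" using k zero_le_power2[of k] by linarith
      qed
      moreover have "(k - 1) * (5 * k - 4) > 0" using k by (intro mult_pos_pos) auto
      moreover have "2 * k * t\<^sup>2 + 4 * t\<^sup>2 \<ge> 0" using k by simp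
      ultimately show ?thesis by linarith
    qed
    also have "\<dots> \<le> (2 * m) * (2 * l * (k + 2 * l))"
      using m(2) False l k l1 by (intro mult_right_mono) auto
    finally show ?thesis by (simp add: algebra_simps)
  qed
  then have "(k + l) * (2 * l) / (k + 2 * l) < 2 * m * ((2 * l)\<^sup>2 / (k * (2 * l + k - 1)))"
    using k l1 by (simp add: divide_simps power2_eq_square) (simp add: algebra_simps)
  also have "\<dots> \<le> 2 * m * \<tau>" using \<tau> m0 by (intro mult_left_mono) auto
  finally have *: "(k + l) * (2 * l) / (k + 2 * l) < 2 * m * \<tau>" .
  have "A / (2 * (k + l)) \<le> \<tau> + 1 - k / (k + 2 * l) / 2" using A by linarith
  then have "A \<le> 2 * (k + l) * (\<tau> + 1 - k / (k + 2 * l) / 2)"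
    using k l1 by (simp add: pos_divide_le_eq mult.commute)
  also have "\<dots> = 2 * (k + l) * \<tau> + (k + l) + (k + l) * (2 * l) / (k + 2 * l)"
    using k l1 by (simp add: field_simps)
  finally have "A \<le> 2 * (k + l) * \<tau> + (k + l) + (k + l) * (2 * l) / (k + 2 * l)" .
  with * show ?thesis by (simp add: algebra_simps)
qed

section \<open>Stars with additional edges between the leaves\<close>

locale hub_network = network a for a :: "'a \<Rightarrow> 'a \<Rightarrow> real" +
  fixes P :: "'a set" and v :: 'a
  assumes finP: "finite P" and vP: "v \<notin> P"
    and hub: "p \<in> P \<Longrightarrow> a v p = 1" and a01: "a i j = 0 \<or> a i j = 1"
begin

lemma hub': "p \<in> P \<Longrightarrow> a p v = 1"
  using hub a_sym by metis

lemma sum_hub: "(\<Sum>i\<in>insert v P. f i) = f v + (\<Sum>i\<in>P. f i)" for f :: "'a \<Rightarrow> real"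
  using finP vP by simp

lemma wdeg_hub: "wdeg a (insert v P) v = real (card P)"
  unfolding wdeg_def sum_hub using hub by (simp add: a_irrefl)

lemma wdeg_leaf: "p \<in> P \<Longrightarrow> wdeg a (insert v P) p = 1 + wdeg a P p"
  unfolding wdeg_def sum_hub using hub' by simp

lemma vol_hub: "vol a (insert v P) = 2 * real (card P) + vol a P"
  unfolding vol_def sum_hub wdeg_hub by (simp add: wdeg_leaf sum.distrib cong: sum.cong)

lemma wdeg_leaf_le: "p \<in> P \<Longrightarrow> wdeg a (insert v P) p \<le> real (card P)"
proof -
  assume p: "p \<in> P"
  have "wdeg a P p = (\<Sum>j\<in>P - {p}. a p j)"
    unfolding wdeg_def using sum.remove[OF finP p, of "a p"] by (simp add: a_irrefl)
  also have "\<dots> \<le> (\<Sum>j\<in>P - {p}. 1)"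
    using a01 by (intro sum_mono) (metis order_refl zero_le_one)
  also have "\<dots> = real (card P) - 1"
    using finP p by (simp add: card_Diff_singleton of_nat_diff card_gt_0_iff Suc_le_eq)
      (metis One_nat_def Suc_leI card_gt_0_iff empty_iff of_nat_1 of_nat_diff)
  finally show ?thesis using p by (simp add: wdeg_leaf)
qed

lemma wdeg_hub_pos:
  assumes "P \<noteq> {}" "i \<in> insert v P"
  shows "wdeg a (insert v P) i > 0"
  using assms finP wdeg_nonneg[of P i] by (auto simp: wdeg_hub wdeg_leaf card_gt_0_iff)

lemma hub_green_exists: "\<exists>g. green a (insert v P) v g"
proof (rule green_exists)
  fix x :: "'a \<Rightarrow> real" and i
  assume "x v = 0" "\<And>i j. i \<in> insert v P \<Longrightarrow> j \<in> insert v P \<Longrightarrow> a i j > 0 \<Longrightarrow> x i = x j"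
    and "i \<in> insert v P"
  then show "x i = 0" using hub[of i] by (metis insertE insertI1 zero_less_one)
qed (simp_all add: finP)

context
  fixes g assumes g: "green a (insert v P) v g"
begin

text \<open>The entry \<open>g i i\<close> is the effective resistance between \<open>i\<close> and
  \<open>v\<close>. The test functions are combinations of a point mass at \<open>i\<close> and a
  constant on \<open>P\<close>; their energy depends only on \<open>d\<close> and \<open>k\<close>,
  whatever the other edges are.\<close>

lemma green_diag_ge:
  assumes i: "i \<in> P" and k: "card P \<ge> 2"
  defines "d \<equiv> wdeg a (insert v P) i" and "k \<equiv> real (card P)"
  shows "(d + k - 2) / (k * d - 1) \<le> g i i"
proof -
  let ?V = "insert v P"
  have finV: "finite ?V" and vV: "v \<in> ?V" using finP by auto
  have iv: "i \<noteq> v" using i vP by auto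
  have d1: "d \<ge> 1" using i wdeg_nonneg[of P i] by (simp add: d_def wdeg_leaf)
  have k2: "k \<ge> 2" using k by (simp add: k_def)
  have D: "k * d - 1 > 0" using mult_mono[of 2 k 1 d] d1 k2 by simp
  \<comment> \<open>These coefficients maximise the dual functional over \<open>\<alpha> e\<^sub>i + \<beta> 1\<^sub>P\<close>.\<close>
  define \<alpha> where "\<alpha> = (k - 1) / (k * d - 1)"
  define \<beta> where "\<beta> = (d - 1) / (k * d - 1)"
  \<comment> \<open>The first two are the stationarity conditions of 2 (\<alpha> + \<beta>) -
    (\<alpha>^2 d + 2 \<alpha> \<beta> + \<beta>^2 k). They make the energy equal to \<alpha> +
    \<beta>, hence also the dual functional.\<close>
  have ab: "\<alpha> * d + \<beta> = 1" "\<alpha> + \<beta> * k = 1" "\<alpha> + \<beta> = (d + k - 2) / (k * d - 1)"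
    using D unfolding \<alpha>_def \<beta>_def
    by (simp_all add: add_divide_distrib[symmetric] divide_eq_1_iff) (simp_all add: algebra_simps)
  define y where "y = (\<lambda>j. if j \<in> P then \<alpha> * of_bool (j = i) + \<beta> else 0)"
  have yv: "y v = 0" using vP by (simp add: y_def)
  have lapy: "lap a ?V y j = \<alpha> * (d * of_bool (j = i)) - \<alpha> * a j i + \<beta>" if j: "j \<in> P" for j
  proof -
    have "(\<Sum>n\<in>?V. a j n * y n) = (\<Sum>n\<in>P. \<alpha> * (a j n * of_bool (n = i)) + \<beta> * a j n)"
      unfolding sum_hub using yv by (simp add: y_def algebra_simps)
    also have "\<dots> = \<alpha> * a j i + \<beta> * wdeg a P j"
      using i by (simp only: sum.distrib sum_distrib_left[symmetric] sum_mult_of_bool[OF finP] wdeg_def)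
    finally show ?thesis
      using j unfolding lap_def by (auto simp: y_def wdeg_leaf d_def algebra_simps)
  qed
  have "energy a ?V y y = (\<Sum>j\<in>P. y j * lap a ?V y j)"
    unfolding sum_lap[symmetric] sum_hub using yv by simp
  also have "\<dots> = (\<Sum>j\<in>P. of_bool (j = i) * (\<alpha> * \<alpha> * d + \<alpha> * \<beta> * d + \<alpha> * \<beta> - \<alpha> * \<alpha> * a j i)
      - \<alpha> * \<beta> * a i j + \<beta> * \<beta>)"
    using i by (intro sum.cong refl) (simp add: lapy, simp add: y_def algebra_simps a_sym)
  also have "\<dots> = \<alpha> * \<alpha> * d + \<alpha> * \<beta> * d + \<alpha> * \<beta> - \<alpha> * \<beta> * wdeg a P i + k * (\<beta> * \<beta>)"
    using i by (simp only: sum.distrib sum_subtractf sum_mult_of_bool[OF finP] a_irrefl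
        sum_distrib_left[symmetric] wdeg_def) (simp add: k_def)
  also have "\<dots> = \<alpha> * (\<alpha> * d + \<beta>) + \<beta> * (\<alpha> + \<beta> * k)"
    using i by (simp add: d_def wdeg_leaf algebra_simps)
  also have "\<dots> = \<alpha> + \<beta>" by (simp add: ab)
  finally have en: "energy a ?V y y = \<alpha> + \<beta>" .
  have "lap a ?V (\<lambda>n. g n i) j = of_bool (j = i) - of_bool (j = v)" if "j \<in> ?V" for j
    using green_lap[OF finV vV g that] i by simp
  note energy_dual[OF this, where y = y]
  moreover have "(\<Sum>j\<in>?V. (of_bool (j = i) - of_bool (j = v)) * z j) = z i - z v" for z :: "'a \<Rightarrow> real"
    unfolding left_diff_distrib sum_subtractf
    using i sum_mult_of_bool(1)[OF finV, of i z] sum_mult_of_bool(1)[OF finV vV, of z] by simp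
  ultimately have "2 * (y i - y v) - energy a ?V y y \<le> g i i - g v i"
    by simp
  then show ?thesis
    using i iv by (simp add: en yv green_v[OF finV vV g] ab(3)[symmetric]) (simp add: y_def)
qed

text \<open>By \<open>green_diag_ge\<close>, a leaf with f neighbours in \<open>P\<close>
  contributes an excess over 1 of at least f^2 / (k f + k - 1). Cauchy-Schwarz combines these: the f
  add up to \<open>vol a P\<close>, the denominators to k (vol + k - 1).\<close>

lemma hub_gtrace_ge:
  assumes k: "card P \<ge> 2"
  defines "k \<equiv> real (card P)"
  shows "(vol a P)\<^sup>2 / (k * (vol a P + k - 1)) \<le> gtrace a (insert v P) g - k"
proof -
  let ?V = "insert v P"
  have finV: "finite ?V" and vV: "v \<in> ?V" using finP by auto
  have k2: "k \<ge> 2" using k by (simp add: k_def)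
  define f where "f = wdeg a P"
  have f0: "f i \<ge> 0" for i by (simp add: f_def wdeg_nonneg)
  define w where "w = vol a P"
  have fsum: "(\<Sum>i\<in>P. f i) = w" by (simp add: f_def w_def vol_def)
  have w0: "w \<ge> 0" using fsum f0 by (metis sum_nonneg)
  \<comment> \<open>The sum of the f divided by the sum of the denominators, for which the tangent
    bounds add up to the Cauchy-Schwarz bound.\<close>
  define \<theta> where "\<theta> = w / (k * (w + k - 1))"
  have den: "k * (w + k - 1) > 0" using k2 w0 by (intro mult_pos_pos) auto
  have "2 * \<theta> * f i - \<theta>\<^sup>2 * (k * f i + (k - 1)) \<le> (1 + f i) * g i i - 1" if i: "i \<in> P" for i
  proof -
    have pos: "k * f i + (k - 1) > 0" using k2 f0[of i] by (simp add: add_nonneg_pos)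
    have "2 * \<theta> * f i - \<theta>\<^sup>2 * (k * f i + (k - 1)) \<le> (f i)\<^sup>2 / (k * f i + (k - 1))"
      using pos by (rule quotient_ge_tangent)
    also have "\<dots> = (1 + f i) * ((1 + f i + k - 2) / (k * (1 + f i) - 1)) - 1"
    proof -
      have "k * (1 + f i) - 1 = k * f i + (k - 1)" by (simp add: algebra_simps)
      then show ?thesis using pos by (simp add: field_simps power2_eq_square)
    qed
    also have "\<dots> \<le> (1 + f i) * g i i - 1"
      using green_diag_ge[OF i k] i f0[of i]
      by (intro diff_right_mono mult_left_mono) (auto simp: wdeg_leaf f_def k_def)
    finally show ?thesis .
  qed
  then have "(\<Sum>i\<in>P. 2 * \<theta> * f i - \<theta>\<^sup>2 * (k * f i + (k - 1))) \<le> (\<Sum>i\<in>P. (1 + f i) * g i i - 1)"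
    by (rule sum_mono)
  also have "\<dots> = gtrace a ?V g - k"
    unfolding gtrace_def sum_hub using green_v[OF finV vV g]
    by (simp add: sum_subtractf wdeg_leaf f_def k_def cong: sum.cong)
  also have "(\<Sum>i\<in>P. 2 * \<theta> * f i - \<theta>\<^sup>2 * (k * f i + (k - 1))) = 2 * \<theta> * w - \<theta>\<^sup>2 * (k * w + k * (k - 1))"
    by (simp only: sum_subtractf sum.distrib sum_distrib_left[symmetric] fsum) (simp add: k_def algebra_simps)
  also have "\<theta>\<^sup>2 * (k * w + k * (k - 1)) = \<theta> * w"
  proof -
    have "w / D * D = w" if "D > 0" for D :: real using that by simp
    from this[OF den] have "\<theta> * (k * (w + k - 1)) = w" by (simp only: \<theta>_def)
    then have "\<theta> * (\<theta> * (k * (w + k - 1))) = \<theta> * w" by (simp only:)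
    then show ?thesis by (simp add: power2_eq_square algebra_simps)
  qed
  finally show ?thesis by (simp add: \<theta>_def w_def power2_eq_square)
qed

text \<open>The right side is the trace of P^2. Degrees of leaves are at most k, the degree of the
  hub, so the row of each leaf contributes at least 1 / k, together 1. The row of the hub gives the
  mean of 1 / d over the leaves, bounded below by the inverse of the mean degree.\<close>

lemma hub_return_ge:
  assumes k: "P \<noteq> {}"
  defines "k \<equiv> real (card P)"
  shows "1 + k / (k + vol a P) \<le>
    (\<Sum>i\<in>insert v P. \<Sum>j\<in>insert v P. (a i j)\<^sup>2 / (wdeg a (insert v P) i * wdeg a (insert v P) j))"
proof -
  define d where "d = wdeg a (insert v P)"
  have k0: "k > 0" using k finP by (simp add: k_def card_gt_0_iff)
  have dv: "d v = k" by (simp add: d_def wdeg_hub k_def)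
  have d: "d i = 1 + wdeg a P i" "d i \<le> k" "d i \<ge> 1" if "i \<in> P" for i
    using that wdeg_leaf wdeg_leaf_le wdeg_nonneg[of P i] by (auto simp: d_def k_def)
  define \<theta> where "\<theta> = k / (k + vol a P)"
  have vol0: "vol a P \<ge> 0" by (simp add: vol_def sum_nonneg wdeg_nonneg)
  have dsum: "(\<Sum>i\<in>P. d i) = k + vol a P"
    using d(1) by (simp add: sum.distrib vol_def k_def cong: sum.cong)
  have t: "k * \<theta> \<le> (\<Sum>i\<in>P. 1 / d i)"
  proof -
    have "(\<Sum>i\<in>P. 2 * \<theta> * 1 - \<theta>\<^sup>2 * d i) \<le> (\<Sum>i\<in>P. 1\<^sup>2 / d i)"
      using d(3) by (intro sum_mono quotient_ge_tangent) force
    also have "(\<Sum>i\<in>P. 2 * \<theta> * 1 - \<theta>\<^sup>2 * d i) = k * (2 * \<theta>) - \<theta>\<^sup>2 * (k + vol a P)"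
      by (simp only: sum_subtractf sum_distrib_left[symmetric] dsum) (simp add: k_def)
    also have "\<dots> = k * \<theta>"
    proof -
      have "\<theta> * (k + vol a P) = k" using k0 vol0 by (simp add: \<theta>_def)
      then show ?thesis by (simp add: power2_eq_square mult.assoc)
    qed
    finally show ?thesis by simp
  qed
  have row: "1 / k \<le> (\<Sum>j\<in>insert v P. (a i j)\<^sup>2 / (d i * d j))" if i: "i \<in> P" for i
  proof -
    have "(\<Sum>j\<in>P. a i j / (d i * k)) \<le> (\<Sum>j\<in>P. (a i j)\<^sup>2 / (d i * d j))"
    proof (rule sum_mono)
      fix j assume j: "j \<in> P"
      have "1 / (d i * k) \<le> 1 / (d i * d j)"
        using d[OF i] d[OF j] by (intro divide_left_mono mult_left_mono mult_pos_pos) auto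
      then show "a i j / (d i * k) \<le> (a i j)\<^sup>2 / (d i * d j)"
        using a01[of i j] by auto
    qed
    moreover have "(\<Sum>j\<in>P. a i j / (d i * k)) = (d i - 1) / (d i * k)"
      using d(1)[OF i] by (simp add: wdeg_def sum_divide_distrib)
    moreover have "(d i - 1) / (d i * k) + 1 / (d i * k) = 1 / k"
      using d(3)[OF i] k0 by (simp add: field_simps)
    ultimately show ?thesis
      unfolding sum_hub using hub'[OF i] by (simp add: dv)
  qed
  have "(\<Sum>i\<in>P. 1 / d i) / k \<ge> \<theta>"
    using t k0 by (simp add: pos_le_divide_eq mult.commute)
  moreover have "(\<Sum>i\<in>P. 1 / k) = 1"
    using k0 by (simp add: k_def)
  moreover have "(\<Sum>i\<in>P. 1 / k) \<le> (\<Sum>i\<in>P. \<Sum>j\<in>insert v P. (a i j)\<^sup>2 / (d i * d j))"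
    by (rule sum_mono) (rule row)
  moreover have "(\<Sum>j\<in>insert v P. (a v j)\<^sup>2 / (d v * d j)) = (\<Sum>i\<in>P. 1 / d i) / k"
    unfolding sum_hub by (simp add: a_irrefl hub dv sum_divide_distrib mult.commute cong: sum.cong)
  ultimately show ?thesis
    unfolding sum_hub[of "\<lambda>i. \<Sum>j\<in>insert v P. F i j" for F] d_def[symmetric] \<theta>_def[symmetric] by linarith
qed

text \<open>The bounds on T and on the trace of P^2 are fed into \<open>hub_arith\<close>, for k + 1
  vertices and k + l edges; \<open>l\<close> counts the edges between leaves.\<close>

lemma hub_gmass_less:
  assumes k: "card P \<ge> 2"
  defines "k \<equiv> real (card P)" and "l \<equiv> vol a P / 2"
  assumes l: "l \<ge> k - 1" and m: "l \<ge> k \<Longrightarrow> 2 * m \<ge> k" "l < k \<Longrightarrow> 2 * m \<ge> l + 2"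
  shows "gmass a (insert v P) g < 2 * (m + k + l) * (gtrace a (insert v P) g - k) + k + l"
proof (rule hub_arith[OF _ l m])
  let ?V = "insert v P"
  have finV: "finite ?V" and vV: "v \<in> ?V" and ne: "P \<noteq> {}" using finP k by auto
  show "k \<ge> 2" using k by (simp add: k_def)
  show "(2 * l)\<^sup>2 / (k * (2 * l + k - 1)) \<le> gtrace a ?V g - k"
    using hub_gtrace_ge[OF k] by (simp add: k_def l_def)
  have "real (card ?V) - 2 + ((\<Sum>i\<in>?V. \<Sum>j\<in>?V. (a i j)\<^sup>2 / (wdeg a ?V i * wdeg a ?V j)) - 1) / 2
      \<le> gtrace a ?V g - gmass a ?V g / vol a ?V"
    by (rule gtrace_gmass_ge[OF finV vV g]) (rule wdeg_hub_pos[OF ne])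
  moreover have "real (card ?V) = k + 1" using finP vP by (simp add: k_def)
  moreover have "2 * (k + l) = vol a ?V" "k + 2 * l = k + vol a P" by (simp_all add: vol_hub k_def l_def)
  moreover have "1 + k / (k + vol a P) \<le>
      (\<Sum>i\<in>?V. \<Sum>j\<in>?V. (a i j)\<^sup>2 / (wdeg a ?V i * wdeg a ?V j))"
    using hub_return_ge[OF ne] by (simp only: k_def)
  moreover have "k - 1 + q / 2 \<le> k + (T - k) - M"
    if "n - 2 + (X - 1) / 2 \<le> T - M" "n = k + 1" "1 + q \<le> X" for n q X T M :: real
    using that by (simp add: field_simps)
  ultimately show "k - 1 + k / (k + 2 * l) / 2 \<le> k + (gtrace a ?V g - k) - gmass a ?V g / (2 * (k + l))"
    by (simp only:)
qed

end
end

section \<open>Reduction to the components of the added edges\<close>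

context hub_network
begin

lemma hub_network_subset: "S \<subseteq> P \<Longrightarrow> hub_network a S v"
  using finP vP hub a01 by unfold_locales (auto intro: finite_subset)

lemma vol_insert_ge:
  assumes "T \<subseteq> P" "i \<in> T" "j \<in> P - T" "a i j \<noteq> 0"
  shows "vol a T + 2 \<le> vol a (insert j T)"
proof -
  have fin: "finite T" using assms finP finite_subset by blast
  have "vol a (insert j T) = (\<Sum>n\<in>T. a j n) + (\<Sum>n\<in>T. a n j + wdeg a T n)"
    using fin assms by (simp add: vol_def wdeg_def a_irrefl)
  also have "\<dots> = 2 * (\<Sum>n\<in>T. a j n) + vol a T"
    by (simp add: vol_def sum.distrib a_sym)
  finally have "vol a (insert j T) = 2 * (\<Sum>n\<in>T. a j n) + vol a T" .
  moreover have "a j i \<le> (\<Sum>n\<in>T. a j n)"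
    using fin assms a_nonneg by (intro member_le_sum) auto
  ultimately show ?thesis using a01[of i j] assms a_sym[of i j] by simp
qed

text \<open>The edge count k - 1 of connected graphs: a set grown from one vertex always has an edge
  leaving it, and adding the far end of this edge gains at least one edge.\<close>

lemma indecomposable_vol_ge:
  assumes "P \<noteq> {}"
    and "\<And>T. T \<noteq> {} \<Longrightarrow> T \<subset> P \<Longrightarrow> \<exists>i\<in>T. \<exists>j\<in>P - T. a i j \<noteq> 0"
  shows "real (card P) - 1 \<le> vol a P / 2"
proof -
  have "\<exists>T\<subseteq>P. card T = Suc n \<and> real n \<le> vol a T / 2" if "Suc n \<le> card P" for n
    using that
  proof (induction n)
    case 0
    obtain p where "p \<in> P" using assms by blast
    then show ?case by (intro exI[of _ "{p}"]) (simp add: vol_def wdeg_def a_irrefl)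
  next
    case (Suc n)
    then obtain T where T: "T \<subseteq> P" "card T = Suc n" "real n \<le> vol a T / 2" by auto
    then have "T \<noteq> {}" "T \<subset> P" using Suc.prems by auto
    then obtain i j where ij: "i \<in> T" "j \<in> P - T" "a i j \<noteq> 0" using assms(2) by blast
    have "finite T" using T finP finite_subset by blast
    then have "card (insert j T) = Suc (Suc n)" using T ij by simp
    then show ?case
      using vol_insert_ge[OF T(1) ij] T ij by (intro exI[of _ "insert j T"]) auto
  qed
  from this[of "card P - 1"] obtain T where "T \<subseteq> P" "card T = card P" "real (card P - 1) \<le> vol a T / 2"
    using assms(1) finP by (auto simp: card_gt_0_iff Suc_le_eq)
  moreover have "card P \<ge> 1" using assms(1) finP by (simp add: card_gt_0_iff Suc_le_eq)
  ultimately show ?thesis using card_subset_eq[OF finP] by (auto simp: of_nat_diff)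
qed

text \<open>Strong induction: a set without crossing edges to its complement splits at the cut
  vertex \<open>v\<close>, and an indecomposable one is covered by \<open>hub_gmass_less\<close> or
  is a single leaf. \<open>g\<close> is existentially quantified because it is built by gluing. The
  bound \<open>card S \<le> gtrace\<close> is carried along for the superadditivity of the right
  side.\<close>

lemma hub_green_gmass_le:
  fixes e :: "'a set \<Rightarrow> nat" and m :: nat
  assumes e: "\<And>S. S \<subseteq> P \<Longrightarrow> vol a S = 2 * real (e S)"
    and "S \<subseteq> P" "S \<noteq> {}" "if e S \<ge> card S then 2 * m \<ge> card S else 2 * m \<ge> e S + 2"
  shows "\<exists>g. green a (insert v S) v g \<and> real (card S) \<le> gtrace a (insert v S) g \<and>
    gmass a (insert v S) g \<le> 2 * (real m + card S + e S) * (gtrace a (insert v S) g - card S) + card S + e S \<and>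
    (e S > 0 \<longrightarrow> gmass a (insert v S) g <
       2 * (real m + card S + e S) * (gtrace a (insert v S) g - card S) + card S + e S)"
  using assms(2-)
proof (induction "card S" arbitrary: S rule: less_induct)
  case less
  have finS: "finite S" using less.prems finP finite_subset by blast
  interpret H: hub_network a S v by (rule hub_network_subset[OF less.prems(1)])
  show ?case
  proof (cases "\<exists>T. T \<noteq> {} \<and> T \<subset> S \<and> (\<forall>i\<in>T. \<forall>j\<in>S - T. a i j = 0)")
    case True
    then obtain T where T: "T \<noteq> {}" "T \<subset> S" and sep: "\<And>i j. i \<in> T \<Longrightarrow> j \<in> S - T \<Longrightarrow> a i j = 0"
      by blast
    let ?U = "S - T"
    have U: "?U \<noteq> {}" "?U \<subset> S" using T by auto
    have lt: "card T < card S" "card ?U < card S" using T U finS by (auto intro: psubset_card_mono)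
    have cardS: "card S = card T + card ?U"
      using T finS by (metis card_Un_disjoint Diff_disjoint Diff_partition finite_Diff finite_subset psubset_imp_subset)
    have vs: "v \<notin> S" using less.prems vP by auto
    have eS: "e S = e T + e ?U"
    proof -
      have "vol a S = vol a T + vol a ?U"
      proof -
        have "vol a S = (\<Sum>i\<in>T. wdeg a S i) + (\<Sum>i\<in>?U. wdeg a S i)"
          unfolding vol_def using T finS by (metis add.commute psubset_imp_subset sum.subset_diff)
        also have "(\<Sum>i\<in>T. wdeg a S i) = vol a T"
          unfolding vol_def wdeg_def
          using T finS sep by (intro sum.cong refl sum.mono_neutral_right) auto
        also have "(\<Sum>i\<in>?U. wdeg a S i) = vol a ?U"
          unfolding vol_def wdeg_def
          using T finS sep a_sym by (intro sum.cong refl sum.mono_neutral_right) (auto, metis)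
        finally show ?thesis .
      qed
      then show ?thesis
        using e[OF less.prems(1)] e[of T] e[of ?U] less.prems(1) T
        by (simp add: psubset_eq subset_trans[of _ S P])
    qed
    \<comment> \<open>If the branch changes to \<open>e X < card X\<close> while
      \<open>e S \<ge> card S\<close>, then \<open>e X + 2 \<le> card X + 1 \<le> card S\<close>; in
      the opposite change \<open>card X \<le> e X \<le> e S\<close>.\<close>
    have cond: "if e X \<ge> card X then 2 * m \<ge> card X else 2 * m \<ge> e X + 2"
      if "card X < card S" "e X \<le> e S" for X
      using that less.prems(3) by (auto split: if_splits)
    have subs: "T \<subseteq> P" "?U \<subseteq> P" and le: "e T \<le> e S" "e ?U \<le> e S"
      using T less.prems(1) eS by auto
    obtain g1 where g1: "green a (insert v T) v g1" "real (card T) \<le> gtrace a (insert v T) g1"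
      "gmass a (insert v T) g1 \<le> 2 * (real m + card T + e T) * (gtrace a (insert v T) g1 - card T) + card T + e T"
      "e T > 0 \<longrightarrow> gmass a (insert v T) g1 < 2 * (real m + card T + e T) * (gtrace a (insert v T) g1 - card T) + card T + e T"
      using less.hyps[OF lt(1) subs(1) T(1) cond[OF lt(1) le(1)]] by (elim exE conjE) (rule that)
    obtain g2 where g2: "green a (insert v ?U) v g2" "real (card ?U) \<le> gtrace a (insert v ?U) g2"
      "gmass a (insert v ?U) g2 \<le> 2 * (real m + card ?U + e ?U) * (gtrace a (insert v ?U) g2 - card ?U) + card ?U + e ?U"
      "e ?U > 0 \<longrightarrow> gmass a (insert v ?U) g2 < 2 * (real m + card ?U + e ?U) * (gtrace a (insert v ?U) g2 - card ?U) + card ?U + e ?U"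
      using less.hyps[OF lt(2) subs(2) U(1) cond[OF lt(2) le(2)]] by (elim exE conjE) (rule that)
    let ?V1 = "insert v T" and ?V2 = "insert v ?U"
    have fin: "finite ?V1" "finite ?V2" and cut: "?V1 \<inter> ?V2 = {v}" and un: "insert v S = ?V1 \<union> ?V2"
      using finS T finite_subset[of T S] by auto
    have sepV: "a i j = 0" if "i \<in> ?V1 - {v}" "j \<in> ?V2 - {v}" for i j using that sep by auto
    let ?g = "glue ?V1 ?V2 g1 g2"
    have gr: "green a (insert v S) v ?g" unfolding un
      by (rule green_glue[OF fin cut _ g1(1) g2(1)]) (rule sepV)
    have tr: "gtrace a (insert v S) ?g = gtrace a ?V1 g1 + gtrace a ?V2 g2" unfolding un
      by (rule gtrace_glue[OF fin cut _ g1(1) g2(1)]) (rule sepV)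
    have ma: "gmass a (insert v S) ?g = gmass a ?V1 g1 + gmass a ?V2 g2" unfolding un
      by (rule gmass_glue[OF fin cut _ g1(1) g2(1)]) (rule sepV)
    \<comment> \<open>Joining two parts only adds products of the size of one part with the excess T
      - k of the other, which are nonnegative.\<close>
    define R where "R = (\<lambda>X (t :: real). 2 * (real m + card X + e X) * (t - card X) + card X + e X)"
    have sup: "R T (gtrace a ?V1 g1) + R ?U (gtrace a ?V2 g2) \<le> R S (gtrace a ?V1 g1 + gtrace a ?V2 g2)"
    proof -
      define t1 where "t1 = gtrace a ?V1 g1 - card T"
      define t2 where "t2 = gtrace a ?V2 g2 - card ?U"
      have t: "t1 \<ge> 0" "t2 \<ge> 0" using g1(2) g2(2) by (auto simp: t1_def t2_def)
      have eq: "gtrace a ?V1 g1 = t1 + card T" "gtrace a ?V2 g2 = t2 + card ?U"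
        by (simp_all add: t1_def t2_def)
      have "R S (gtrace a ?V1 g1 + gtrace a ?V2 g2) - (R T (gtrace a ?V1 g1) + R ?U (gtrace a ?V2 g2))
        = 2 * (real (card ?U) + e ?U) * t1 + 2 * (real (card T) + e T) * t2"
        unfolding R_def eq cardS eS by (simp add: algebra_simps)
      moreover have "\<dots> \<ge> 0" using t by simp
      ultimately show ?thesis by linarith
    qed
    have "gmass a (insert v S) ?g \<le> R S (gtrace a (insert v S) ?g)"
      unfolding tr ma using g1(3) g2(3) sup unfolding R_def by linarith
    moreover have "gmass a (insert v S) ?g < R S (gtrace a (insert v S) ?g)" if "e S > 0"
    proof (cases "e T > 0")
      case True
      then show ?thesis using g1(4)[rule_format, OF True] g2(3) sup unfolding tr ma R_def by linarith
    next
      case False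
      then have "e ?U > 0" using that eS by simp
      then show ?thesis using g1(3) g2(4)[rule_format, OF \<open>e ?U > 0\<close>] sup unfolding tr ma R_def by linarith
    qed
    moreover have "real (card S) \<le> gtrace a (insert v S) ?g" using tr cardS g1(2) g2(2) by simp
    ultimately show ?thesis using gr unfolding R_def by (intro exI[of _ ?g] conjI impI)
  next
    case False
    have vs: "v \<notin> S" using less.prems vP by auto
    have finV: "finite (insert v S)" and vV: "v \<in> insert v S" using finS by auto
    obtain g where g: "green a (insert v S) v g" using H.hub_green_exists by blast
    have l: "real (card S) - 1 \<le> vol a S / 2"
      using False less.prems(2) by (intro H.indecomposable_vol_ge) blast+
    have eS: "vol a S / 2 = real (e S)" using e[OF less.prems(1)] by simp
    show ?thesis
    proof (cases "card S \<ge> 2")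
      case True
      have "gmass a (insert v S) g < 2 * (real m + card S + e S) * (gtrace a (insert v S) g - card S) + card S + e S"
      proof (rule H.hub_gmass_less[OF g True l, of "real m", unfolded eS])
        show "real (card S) \<le> 2 * real m" if "real (card S) \<le> real (e S)"
          using that less.prems(3) by (simp split: if_splits)
        show "real (e S) + 2 \<le> 2 * real m" if "real (e S) < real (card S)"
          using that less.prems(3) by (simp split: if_splits)
      qed
      moreover have "0 \<le> (vol a S)\<^sup>2 / (card S * (vol a S + card S - 1))"
        using True eS by (intro divide_nonneg_nonneg mult_nonneg_nonneg) auto
      then have "real (card S) \<le> gtrace a (insert v S) g"
        using H.hub_gtrace_ge[OF g True] by simp
      ultimately show ?thesis using g by (intro exI[of _ g]) simp
    next
      case False
      \<comment> \<open>A single leaf has T = A = 1 and attains equality, so strictness can only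
        come from a part with an edge.\<close>
      have "card S = 1" using False less.prems(2) finS by (cases "card S") auto
      then obtain s where s: "S = {s}" by (auto simp: card_1_singleton_iff)
      have "vol a S = 0" by (simp add: s vol_def wdeg_def a_irrefl)
      then have e0: "e S = 0" using eS by simp
      have d: "wdeg a (insert v S) s = 1" using H.wdeg_leaf[of s] by (simp add: s wdeg_def a_irrefl)
      have sv: "s \<noteq> v" using vs s by auto
      have gv: "g v i = 0" "g i v = 0" for i using green_v[OF finV vV g] by auto
      have "lap a (insert v S) (\<lambda>n. g n s) s = 1" using green_lap[OF finV vV g, of s s] sv s by simp
      then have gss: "g s s = 1" using sv s d by (simp add: lap_def gv a_irrefl)
      have "gtrace a (insert v S) g = 1" "gmass a (insert v S) g = 1"
        using sv d unfolding gtrace_def gmass_def s by (simp_all add: gv gss)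
      then show ?thesis using g e0 s by (intro exI[of _ g]) simp
    qed
  qed
qed

end

section \<open>The threshold on the number of edges\<close>

lemma quadratic_greater_of_root_less:
  fixes m b c :: real
  assumes "m > (sqrt (b\<^sup>2 + 16 * c) - b) / 8" "b \<ge> 0" "c \<ge> 0"
  shows "c < 4 * m\<^sup>2 + b * m"
proof -
  have "sqrt (b\<^sup>2 + 16 * c) < 8 * m + b" using assms(1) by simp
  moreover have "0 \<le> sqrt (b\<^sup>2 + 16 * c)" using assms by simp
  ultimately have "(sqrt (b\<^sup>2 + 16 * c))\<^sup>2 < (8 * m + b)\<^sup>2"
    by (intro power_strict_mono) auto
  then show ?thesis using assms by (simp add: power2_eq_square algebra_simps)
qed

text \<open>The threshold is the positive root of 4 m^2 + b m - c, with b = l + 1 and c = (l + 1) (2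
  l + 1), or b = k + 1 and c = 2 k (k - 1). The quadratic is not positive for 2 m up to l + 1 or k -
  1 respectively, so 2 m exceeds this number, and integrality gives the claim.\<close>

lemma edge_threshold:
  fixes k l m :: nat
  assumes "k \<ge> 2" "l \<ge> 1"
    and m: "real m > (if l < k
            then (sqrt (33 * real l ^ 2 + 50 * real l + 17) - real l - 1) / 8
            else (sqrt (33 * real k ^ 2 - 30 * real k + 1) - real k - 1) / 8)"
  shows "if l \<ge> k then 2 * m \<ge> k else 2 * m \<ge> l + 2"
proof (cases "l < k")
  case True
  define q where "q = real l + 1"
  have "q * (2 * q - 1) < 4 * (real m)\<^sup>2 + q * m"
  proof (rule quadratic_greater_of_root_less)
    have "q\<^sup>2 + 16 * (q * (2 * q - 1)) = 33 * real l ^ 2 + 50 * real l + 17"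
      by (simp add: q_def power2_eq_square algebra_simps)
    then show "(sqrt (q\<^sup>2 + 16 * (q * (2 * q - 1))) - q) / 8 < real m"
      using m True by (simp add: q_def)
  qed (simp_all add: q_def)
  moreover have "4 * (real m)\<^sup>2 + q * m \<le> q * (2 * q - 1)" if "2 * real m \<le> q"
  proof -
    have q2: "q \<ge> 2" using assms(2) by (simp add: q_def)
    have "4 * (real m)\<^sup>2 = (2 * real m) * (2 * real m)" by (simp add: power2_eq_square)
    also have "\<dots> \<le> q * q" using that by (intro mult_mono) auto
    finally have "4 * (real m)\<^sup>2 \<le> q * q" .
    moreover have "q * m \<le> q * (q / 2)" using that q2 by (intro mult_left_mono) auto
    moreover have "2 * q \<le> q * q" using q2 by (intro mult_right_mono) auto
    ultimately show ?thesis by (simp add: algebra_simps)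
  qed
  ultimately have "2 * real m > q" by force
  then show ?thesis using True by (simp add: q_def)
next
  case False
  define q where "q = real k"
  have q2: "q \<ge> 2" using assms(1) by (simp add: q_def)
  have "2 * q * (q - 1) < 4 * (real m)\<^sup>2 + (q + 1) * m"
  proof (rule quadratic_greater_of_root_less)
    have "(q + 1)\<^sup>2 + 16 * (2 * q * (q - 1)) = 33 * real k ^ 2 - 30 * real k + 1"
      by (simp add: q_def power2_eq_square algebra_simps)
    then show "(sqrt ((q + 1)\<^sup>2 + 16 * (2 * q * (q - 1))) - (q + 1)) / 8 < real m"
      using m False by (simp add: q_def)
  qed (use q2 in simp_all)
  moreover have "4 * (real m)\<^sup>2 + (q + 1) * m \<le> 2 * q * (q - 1)" if "2 * real m \<le> q - 1"
  proof -
    have "4 * (real m)\<^sup>2 = (2 * real m) * (2 * real m)" by (simp add: power2_eq_square)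
    also have "\<dots> \<le> (q - 1) * (q - 1)" using that by (intro mult_mono) auto
    finally have "4 * (real m)\<^sup>2 \<le> (q - 1) * (q - 1)" .
    moreover have "(q + 1) * m \<le> (q + 1) * ((q - 1) / 2)" using that q2 by (intro mult_left_mono) auto
    moreover have "1 \<le> q * q" using q2 mult_mono[of 1 q 1 q] by simp
    ultimately show ?thesis using q2 by (simp add: algebra_simps)
  qed
  ultimately have "\<not> 2 * real m \<le> q - 1" by force
  then show ?thesis using False by (simp add: q_def)
qed

text \<open>Grounding the centre leaves the identity matrix on the leaves as Laplacian.\<close>

lemma star_green:
  assumes "finite P" "v \<notin> P"
  defines "g \<equiv> \<lambda>i j. of_bool (i = j \<and> i \<noteq> v)" and "a \<equiv> adj (edges (star_graph v P))"
  shows "green a (insert v P) v g"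
    "gtrace a (insert v P) g = real (card P)" "gmass a (insert v P) g = real (card P)"
proof -
  have a: "a i j = 0" "a i v = 1" if "i \<in> P" "j \<in> P" for i j
    using that assms(2) by (auto simp: a_def adj_def star_graph_def doubleton_eq_iff insert_commute)
  have d: "wdeg a (insert v P) i = 1" if "i \<in> P" for i
    using assms(1,2) that by (simp add: wdeg_def a)
  show "green a (insert v P) v g"
    unfolding green_def
  proof (intro conjI allI ballI)
    fix i j assume ij: "i \<in> insert v P - {v}" "j \<in> insert v P"
    then show "lap a (insert v P) (\<lambda>n. g n j) i = of_bool (i = j)"
      using assms(1,2) by (simp add: lap_def d a) (auto simp: g_def)
  qed (simp_all add: g_def)
  have count: "(\<Sum>i\<in>insert v P. of_bool (i \<noteq> v)) = real (card P)"
  proof -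
    have "(\<Sum>i\<in>P. of_bool (i \<noteq> v)) = (\<Sum>i\<in>P. 1 :: real)"
      using assms(2) by (intro sum.cong) auto
    then show ?thesis using assms(1,2) by simp
  qed
  have "gtrace a (insert v P) g = (\<Sum>i\<in>insert v P. of_bool (i \<noteq> v))"
    unfolding gtrace_def using d by (intro sum.cong) (auto simp: g_def)
  then show "gtrace a (insert v P) g = real (card P)" by (simp only: count)
  have "(\<Sum>j\<in>insert v P. wdeg a (insert v P) i * wdeg a (insert v P) j * g i j) = of_bool (i \<noteq> v)"
    if i: "i \<in> insert v P" for i
  proof -
    have "(\<Sum>j\<in>insert v P. wdeg a (insert v P) i * wdeg a (insert v P) j * g i j)
        = (\<Sum>j\<in>insert v P. of_bool (i = j) * of_bool (j \<noteq> v))"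
      using d i by (intro sum.cong) (auto simp: g_def)
    then show ?thesis using assms(1) i by (simp only: sum_mult_of_bool finite_insert)
  qed
  then have "gmass a (insert v P) g = (\<Sum>i\<in>insert v P. of_bool (i \<noteq> v))"
    unfolding gmass_def by (intro sum.cong) auto
  then show "gmass a (insert v P) g = real (card P)" by (simp only: count)
qed

theorem theorem4p7:
  fixes G1 G :: "'a ugraph" and v :: 'a and P :: "'a set" and L :: "'a set set"
    and k l :: nat
  assumes "simple_graph G1" and "connected_graph G1" and "v \<in> verts G1"
    and "finite P" and "card P = k" and "P \<inter> verts G1 = {}" and "k \<ge> 2"
    and "G = graph_union G1 (star_graph v P)"
    and "L \<subseteq> non_edges (star_graph v P)" and "card L = l" and "l \<ge> 1"
    and "real (card (edges G1)) >
           (if l < k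
            then (sqrt (33 * real l ^ 2 + 50 * real l + 17) - real l - 1) / 8
            else (sqrt (33 * real k ^ 2 - 30 * real k + 1) - real k - 1) / 8)"
  shows "braess_set G L"
proof -
  define m where "m = card (edges G1)"
  define H where "H = add_edges (star_graph v P) L"
  have vP: "v \<notin> P" using assms(3,6) by auto
  have Pne: "P \<noteq> {}" using assms(5,7) by auto
  have L: "e \<subseteq> P \<and> card e = 2" if "e \<in> L" for e
  proof -
    have e: "e \<subseteq> insert v P" "card e = 2" "e \<notin> (\<lambda>p. {v, p}) ` P"
      using that assms(9) by (auto simp: non_edges_def star_graph_def)
    have "v \<notin> e"
    proof
      assume "v \<in> e"
      then obtain p where "e = {v, p}" "p \<noteq> v" using e(2) by (auto simp: card_2_iff)
      then show False using e by auto
    qed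
    then show ?thesis using e by auto
  qed
  \<comment> \<open>The square roots are used only here; the comparison itself needs just these
    linear bounds.\<close>
  have m: "if l \<ge> k then 2 * m \<ge> k else 2 * m \<ge> l + 2"
    using edge_threshold[OF assms(7,11), of m] assms(12) by (simp add: m_def)
  have m1: "m \<ge> 1" using m assms(7) by (auto split: if_splits)
  then have E1: "edges G1 \<noteq> {}" by (auto simp: m_def)

  obtain g1 where g1: "green (adj (edges G1)) (verts G1) v g1"
    using green_exists_connected[OF assms(1-3)] by blast
  note ne1 = connected_nbrs_nonempty[OF assms(1,2) E1]
  define T1 where "T1 = gtrace (adj (edges G1)) (verts G1) g1"
  define A1 where "A1 = gmass (adj (edges G1)) (verts G1) g1"
  have A1: "A1 \<ge> m"
  proof -
    interpret network "adj (edges G1)" using assms(1) by (intro network_adj) (auto simp: simple_graph_def)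
    have fin: "finite (verts G1)" using assms(1) by (simp add: simple_graph_def)
    have "wdeg (adj (edges G1)) (verts G1) i > 0" if "i \<in> verts G1" for i
      using ne1[OF that] fin by (simp add: wdeg_adj deg_def card_gt_0_iff nbrs_def)
    then have "vol (adj (edges G1)) (verts G1) / 2 \<le> A1"
      unfolding A1_def by (rule gmass_ge_half_vol[OF fin assms(3) g1])
    then show ?thesis using vol_simple_graph[OF assms(1)] by (simp add: m_def)
  qed

  have star: "verts (star_graph v P) = insert v P" "edges (star_graph v P) = (\<lambda>p. {v, p}) ` P"
    by (simp_all add: star_graph_def)
  have vH: "verts H = insert v P" and eH: "edges H = (\<lambda>p. {v, p}) ` P \<union> L"
    by (simp_all add: H_def add_edges_def star)
  have sS: "simple_graph (star_graph v P)" and sH: "simple_graph H"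
    using assms(4) L vP by (auto simp: simple_graph_def star vH eH card_2_iff)
  have cut: "verts G1 \<inter> insert v P = {v}" using assms(3,6) by auto
  have card_star: "card (edges (star_graph v P)) = k"
    unfolding star using assms(5) by (subst card_image) (auto simp: inj_on_def doubleton_eq_iff)
  have card_H: "card (edges H) = k + l"
  proof -
    have "(\<lambda>p. {v, p}) ` P \<inter> L = {}" using L vP by blast
    moreover have "finite L" using assms(10,11) by (metis card.infinite not_one_le_zero)
    ultimately show ?thesis
      unfolding eH using assms(4,10) card_star[unfolded star] by (simp add: card_Un_disjoint)
  qed
  have neS: "nbrs (star_graph v P) i \<noteq> {}" if "i \<in> insert v P" for i
    using that Pne by (auto simp: nbrs_def star insert_commute)
  have neH: "nbrs H i \<noteq> {}" if "i \<in> insert v P" for i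
    using neS[OF that] by (auto simp: nbrs_def star vH eH)

  define g0 :: "'a \<Rightarrow> 'a \<Rightarrow> real" where "g0 = (\<lambda>i j. of_bool (i = j \<and> i \<noteq> v))"
  note g0 = star_green[OF assms(4) vP, folded g0_def star(1)]
  have "kemeny G = T1 + gtrace (adj (edges (star_graph v P))) (verts (star_graph v P)) g0 -
    (A1 + gmass (adj (edges (star_graph v P))) (verts (star_graph v P)) g0) /
    (2 * (real (card (edges G1)) + real (card (edges (star_graph v P)))))"
    unfolding assms(8) T1_def A1_def
    by (rule kemeny_graph_union[OF assms(1) sS _ ne1 _ g1 g0(1)]) (simp_all add: star(1) cut neS)
  then have KG: "kemeny G = T1 + k - (A1 + k) / (2 * (real m + k))"
    by (simp only: g0 assms(5) card_star m_def)

  interpret hub_network "adj (edges H)" P v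
  proof -
    interpret network "adj (edges H)" using sH by (intro network_adj) (auto simp: simple_graph_def)
    show "hub_network (adj (edges H)) P v"
      using assms(4) vP by unfold_locales (auto simp: adj_def eH)
  qed
  define e where "e = (\<lambda>S. card {x \<in> edges H. x \<subseteq> S})"
  have "{x \<in> edges H. x \<subseteq> P} = L" using L vP by (auto simp: eH)
  then have eP: "e P = l" by (simp add: e_def assms(10))
  have "vol (adj (edges H)) S = 2 * real (e S)" if "S \<subseteq> P" for S
    unfolding e_def using that assms(4) sH by (intro vol_adj) (auto simp: simple_graph_def intro: finite_subset)
  from hub_green_gmass_le[of e, OF this, of P m] obtain g2 where g2: "green (adj (edges H)) (insert v P) v g2"
    and A2: "gmass (adj (edges H)) (insert v P) g2 <
       2 * (real m + k + l) * (gtrace (adj (edges H)) (insert v P) g2 - k) + k + l"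
    using m Pne assms(5,11) eP by auto
  define T2 where "T2 = gtrace (adj (edges H)) (insert v P) g2"
  define A2 where "A2 = gmass (adj (edges H)) (insert v P) g2"
  \<comment> \<open>The new edges stay within the star, so \<open>v\<close> remains the cut vertex
    and \<open>G1\<close> contributes the same \<open>T1\<close> and \<open>A1\<close> as
    before.\<close>
  have "add_edges G L = graph_union G1 H"
    by (simp add: add_edges_def graph_union_def H_def assms(8) Un_assoc)
  moreover have "kemeny (graph_union G1 H) = T1 + T2 - (A1 + A2) / (2 * (real (card (edges G1)) + real (card (edges H))))"
    unfolding T1_def A1_def T2_def A2_def vH[symmetric]
    by (rule kemeny_graph_union[OF assms(1) sH _ ne1 _ g1]) (simp_all add: vH cut neH g2)
  ultimately have KG': "kemeny (add_edges G L) = T1 + T2 - (A1 + A2) / (2 * (real m + k + l))"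
    by (simp add: card_H m_def add.assoc)

  have "A1 + A2 < 2 * (real m + k + l) * (T2 - k) + (A1 + k + l)"
    using A2 by (simp add: T2_def A2_def)
  \<comment> \<open>Since \<open>A1 \<ge> m\<close>, the mass per edge before the addition is at
    least 1, so scaling it up by \<open>l\<close> further edges gains at least
    \<open>l\<close>.\<close>
  also have "A1 + k + l \<le> (A1 + k) / (real m + k) * (real m + k + l)"
  proof -
    have "1 \<le> (A1 + k) / (real m + k)" using A1 m1 by simp
    then have "l \<le> (A1 + k) / (real m + k) * l"
      using mult_right_mono[of 1 "(A1 + k) / (real m + k)" "real l"] by simp
    moreover have "(A1 + k) / (real m + k) * (real m + k) = A1 + k" using m1 by simp
    ultimately show ?thesis by (simp only: distrib_left)
  qed
  finally have *: "A1 + A2 < 2 * (real m + k + l) * (T2 - k) + (A1 + k) / (real m + k) * (real m + k + l)"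
    by simp
  have "(A1 + A2) / (2 * (real m + k + l)) < T2 - k + (A1 + k) / (2 * (real m + k))"
  proof -
    have "X / (2 * N) < t + c / 2" if "X < 2 * N * t + c * N" "N > 0" for X N t c :: real
      using that by (simp add: field_simps)
    from this[of "A1 + A2" "real m + k + l" "T2 - k" "(A1 + k) / (real m + k)"] show ?thesis
      using * m1 by (simp add: mult.commute)
  qed
  then have "kemeny G < kemeny (add_edges G L)" using KG KG' by simp
  moreover have "L \<subseteq> non_edges G"
  proof
    fix x assume x: "x \<in> L"
    have "x \<notin> edges G1"
    proof
      assume "x \<in> edges G1"
      then have "x \<subseteq> verts G1" using assms(1) by (simp add: simple_graph_def)
      then have "x = {}" using L[OF x] assms(6) by auto
      then show False using L[OF x] by simp
    qed
    moreover have "x \<notin> edges (star_graph v P)" using x assms(9) by (auto simp: non_edges_def)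
    ultimately show "x \<in> non_edges G"
      using L[OF x] by (auto simp: non_edges_def assms(8) graph_union_def star(1))
  qed
  ultimately show ?thesis by (simp add: braess_set_def)
qed

end
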